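(* There exists a universal constant $C>0$ such that the following holds. Let $\Omega\subset\mathbb R^2$ be a compact convex set, let $h>0$, $\theta\in\mathbb R$, $\xi\in\mathbb R^2$, and let $X:=\Omega\cap hR_\theta(\xi+\mathbb Z^2)$, $N:=\#(X)$. Let $u\in\mathrm{Conv}(X)$, and let $\mathcal V$ be the minimal (smallest for inclusion) family of stencils on $X$ such that $u\in\mathrm{Conv}(\mathcal V)$. Then $$\#(\mathcal V)\le C\,N\,\frac{\operatorname{diam}(\Omega)}{h}.$$ (The constant $C$ is independent of $\Omega,h,\theta,\xi,u$.)
   Context: $\|\cdot\|$ is the Euclidean norm, $R_\theta$ the rotation of $\mathbb R^2$ by angle $\theta$, $\operatorname{diam}(\Omega):=\max\{\|y-x\|:x,y\in\Omega\}$. A vector $e=(\alpha,\beta)\in\mathbb Z^2$ is irreducible iff $\gcd(\alpha,\beta)=1$. A basis of $\mathbb Z^2$ is a pair $(f,g)\in(\mathbb Z^2)^2$ with $|\det(f,g)|=1$; direct iff $\det(f,g)=1$, acute iff $\langle f,g\rangle\ge0$. For each irreducible $e$ with $\|e\|>1$ there is a unique direct acute basis $(f,g)$ with $e=f+g$; $f,g$ are called the parents of $e$. Unit vectors have no parents. $\mathrm{Conv}(X)$ is the set of restrictions to $X$ of convex functions $U:\Omega\to\mathbb R$. For $x\in X$ write $x\oplus e:=x+hR_\theta e$. Linear forms: $S_x^e(u):=u(x\oplus e)-2u(x)+u(x\oplus(-e))$ for $e$ irreducible; for $e$ irreducible with $\|e\|>1$, of parents $f,g$, $T_x^e(u):=u(x\oplus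 e)+u(x\oplus(-f))+u(x\oplus(-g))-3u(x)$ and $P_x^e(u):=u(x\oplus e)-u(x\oplus f)-u(x\oplus g)+u(x)$. The support of a form is the set of points at which $u$ is evaluated. $\mathcal V_{\max}(x):=\{e\in\mathbb Z^2\text{ irreducible}: x\oplus e\in X\}$. $\mathrm{Cone}(A)$ is the convex cone generated by $A$, with $\mathrm{Cone}(\emptyset)=\{0\}$. A family of stencils on $X$ is a collection $\mathcal V=(\mathcal V(x))_{x\in X}$, $\mathcal V(x)\subseteq\mathcal V_{\max}(x)$, such that for all $x\in X$: (Stability) any parent $f\in\mathcal V_{\max}(x)$ of any $e\in\mathcal V(x)$ satisfies $f\in\mathcal V(x)$; (Visibility) $\mathrm{Cone}(\mathcal V(x))=\mathrm{Cone}(\mathcal V_{\max}(x))$. The candidates for refinement $\hat{\mathcal V}(x)$ are all $e\in\mathcal V_{\max}(x)\setminus\mathcal V(x)$ having two parents, both in $\mathcal V(x)$. $\mathrm{Conv}(\mathcal V)$ is the set of $u:X\to\mathbb R$ such that for all $x\in X$: $S_x^e(u)\ge0$ for all $e\in\mathcal V(x)$ with $S_x^e$ supported in $X$; $T_x^e(u)\ge0$ for all $e\in\mathcal V(x)$, $\|e\|>1$, with $T_x^e$ supported in $X$; $P_x^e(u)\ge0$ for all $e\in\hat{\mathcal V}(x)$. Families of stencils are ordered by pointwise inclusion; intersections of families of stencils are families of stencils, $\mathrm{Conv}(\mathcal V)\cap\mathrm{Conv}(\mathcal V')=\mathrm{Conv}(\mathcal V\cap\mathcal V')$ and $\mathrm{Conv}(\mathcal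 V_{\max})=\mathrm{Conv}(X)$, so for $u\in \mathrm{Conv}(X)$ a smallest family $\mathcal V$ with $u\in\mathrm{Conv}(\mathcal V)$ exists. $\#(\mathcal V):=\sum_{x\in X}\#(\mathcal V(x))$. *)

theory Defs
  imports "HOL-Analysis.Analysis"
begin

type_synonym plane = "real \<times> real"
type_synonym zvec = "int \<times> int"

definition rvec :: "zvec \<Rightarrow> plane" where
  "rvec e = (real_of_int (fst e), real_of_int (snd e))"

definition rot :: "real \<Rightarrow> plane \<Rightarrow> plane" where
  "rot \<theta> p = (cos \<theta> * fst p - sin \<theta> * snd p, sin \<theta> * fst p + cos \<theta> * snd p)"

definition grid :: "real \<Rightarrow> real \<Rightarrow> plane \<Rightarrow> plane set" where
  "grid h \<theta> \<xi> = range (\<lambda>z. h *\<^sub>R rot \<theta> (\<xi> + rvec z))"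

definition shift :: "real \<Rightarrow> real \<Rightarrow> plane \<Rightarrow> zvec \<Rightarrow> plane" where
  "shift h \<theta> x e = x + h *\<^sub>R rot \<theta> (rvec e)"

definition irred :: "zvec \<Rightarrow> bool" where
  "irred e \<longleftrightarrow> gcd (fst e) (snd e) = 1"

definition direct_acute_basis :: "zvec \<Rightarrow> zvec \<Rightarrow> bool" where
  "direct_acute_basis f g \<longleftrightarrow>
     fst f * snd g - snd f * fst g = 1 \<and> rvec f \<bullet> rvec g \<ge> 0"

text \<open>The parents of \<open>e\<close> are the unique ordered pair \<open>(f, g)\<close> satisfying this relation;
  no pair satisfies it when \<open>e\<close> is a unit vector or is not irreducible.\<close>

definition has_parents :: "zvec \<Rightarrow> zvec \<Rightarrow> zvec \<Rightarrow> bool" where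
  "has_parents e f g \<longleftrightarrow>
     irred e \<and> norm (rvec e) > 1 \<and> direct_acute_basis f g \<and> e = f + g"

definition is_parent :: "zvec \<Rightarrow> zvec \<Rightarrow> bool" where
  "is_parent f e \<longleftrightarrow> (\<exists>g. has_parents e f g \<or> has_parents e g f)"

text \<open>A function on \<open>X\<close> is represented by a total function on the plane of which only the
  values on \<open>X\<close> matter; likewise a family of stencils is only considered at points of \<open>X\<close>.\<close>

definition Conv_restr :: "plane set \<Rightarrow> plane set \<Rightarrow> (plane \<Rightarrow> real) set" where
  "Conv_restr \<Omega> X = {u. \<exists>U. convex_on \<Omega> U \<and> (\<forall>x\<in>X. u x = U x)}"

definition S_form :: "real \<Rightarrow> real \<Rightarrow> plane \<Rightarrow> zvec \<Rightarrow> (plane \<Rightarrow> real) \<Rightarrow> real" where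
  "S_form h \<theta> x e u = u (shift h \<theta> x e) - 2 * u x + u (shift h \<theta> x (- e))"

definition S_supp :: "real \<Rightarrow> real \<Rightarrow> plane \<Rightarrow> zvec \<Rightarrow> plane set" where
  "S_supp h \<theta> x e = {shift h \<theta> x e, x, shift h \<theta> x (- e)}"

text \<open>The forms \<open>T\<close> and \<open>P\<close> take the parents \<open>f\<close>, \<open>g\<close> of \<open>e\<close> as explicit arguments.\<close>

definition T_form ::
  "real \<Rightarrow> real \<Rightarrow> plane \<Rightarrow> zvec \<Rightarrow> zvec \<Rightarrow> zvec \<Rightarrow> (plane \<Rightarrow> real) \<Rightarrow> real" where
  "T_form h \<theta> x e f g u =
     u (shift h \<theta> x e) + u (shift h \<theta> x (- f)) + u (shift h \<theta> x (- g)) - 3 * u x"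

definition T_supp :: "real \<Rightarrow> real \<Rightarrow> plane \<Rightarrow> zvec \<Rightarrow> zvec \<Rightarrow> zvec \<Rightarrow> plane set" where
  "T_supp h \<theta> x e f g =
     {shift h \<theta> x e, shift h \<theta> x (- f), shift h \<theta> x (- g), x}"

definition P_form ::
  "real \<Rightarrow> real \<Rightarrow> plane \<Rightarrow> zvec \<Rightarrow> zvec \<Rightarrow> zvec \<Rightarrow> (plane \<Rightarrow> real) \<Rightarrow> real" where
  "P_form h \<theta> x e f g u =
     u (shift h \<theta> x e) - u (shift h \<theta> x f) - u (shift h \<theta> x g) + u x"

definition Vmax :: "real \<Rightarrow> real \<Rightarrow> plane set \<Rightarrow> plane \<Rightarrow> zvec set" where
  "Vmax h \<theta> X x = {e. irred e \<and> shift h \<theta> x e \<in> X}"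

text \<open>In the library a \<open>convex_cone\<close> contains the origin, so \<open>convex_cone hull {} = {0}\<close>.\<close>

definition Cone :: "zvec set \<Rightarrow> plane set" where
  "Cone A = convex_cone hull (rvec ` A)"

definition stencil_family ::
  "real \<Rightarrow> real \<Rightarrow> plane set \<Rightarrow> (plane \<Rightarrow> zvec set) \<Rightarrow> bool" where
  "stencil_family h \<theta> X V \<longleftrightarrow>
     (\<forall>x\<in>X. V x \<subseteq> Vmax h \<theta> X x \<and>
        (\<forall>e\<in>V x. \<forall>f\<in>Vmax h \<theta> X x. is_parent f e \<longrightarrow> f \<in> V x) \<and>
        Cone (V x) = Cone (Vmax h \<theta> X x))"

definition candidates ::
  "real \<Rightarrow> real \<Rightarrow> plane set \<Rightarrow> (plane \<Rightarrow> zvec set) \<Rightarrow> plane \<Rightarrow> zvec set" where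
  "candidates h \<theta> X V x =
     {e \<in> Vmax h \<theta> X x - V x. \<exists>f g. has_parents e f g \<and> f \<in> V x \<and> g \<in> V x}"

definition Conv_stencil ::
  "real \<Rightarrow> real \<Rightarrow> plane set \<Rightarrow> (plane \<Rightarrow> zvec set) \<Rightarrow> (plane \<Rightarrow> real) set" where
  "Conv_stencil h \<theta> X V =
     {u. \<forall>x\<in>X.
        (\<forall>e\<in>V x. S_supp h \<theta> x e \<subseteq> X \<longrightarrow> S_form h \<theta> x e u \<ge> 0) \<and>
        (\<forall>e\<in>V x. \<forall>f g. has_parents e f g \<longrightarrow> T_supp h \<theta> x e f g \<subseteq> X \<longrightarrow>
           T_form h \<theta> x e f g u \<ge> 0) \<and>
        (\<forall>e\<in>candidates h \<theta> X V x. \<forall>f g. has_parents e f g \<longrightarrow> P_form h \<theta> x e f g u \<ge> 0)}"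

definition smallest_stencil_family ::
  "real \<Rightarrow> real \<Rightarrow> plane set \<Rightarrow> (plane \<Rightarrow> real) \<Rightarrow> (plane \<Rightarrow> zvec set) \<Rightarrow> bool" where
  "smallest_stencil_family h \<theta> X u V \<longleftrightarrow>
     stencil_family h \<theta> X V \<and> u \<in> Conv_stencil h \<theta> X V \<and>
     (\<forall>W. stencil_family h \<theta> X W \<and> u \<in> Conv_stencil h \<theta> X W \<longrightarrow> (\<forall>x\<in>X. V x \<subseteq> W x))"

definition stencil_size :: "plane set \<Rightarrow> (plane \<Rightarrow> zvec set) \<Rightarrow> nat" where
  "stencil_size X V = (\<Sum>x\<in>X. card (V x))"

end

theory Submission
  imports Defs
begin

text \<open>
  The proof counts the elements of the minimal stencils through their leaves. A leaf of \<open>V(x)\<close> is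
  an element that is not a parent of another element of \<open>V(x)\<close>; every element is an ancestor of a
  leaf. The ancestors of \<open>e\<close> form a chain, up to unit vectors at its end, along which
  the \<open>l\<^sub>1\<close> norm decreases (\<open>few_ancestors\<close>), so each leaf accounts for at most
  \<open>O(diam(\<Omega>) / h)\<close> elements. It remains to show that there are only \<open>O(N)\<close> leaves in total.

  A leaf can be removed from its stencil without damage to stability. By minimality
  (\<open>leaf_below_other_diagonal\<close>) it is therefore indispensable for one of two reasons. Either
  its removal shrinks the visibility cone; this concerns at most 8 leaves per point, as of
  three directions in a quadrant the middle one is redundant (\<open>card_needed_rays\<close>). Or the
  parents \<open>f\<close>, \<open>g\<close> of \<open>e\<close> belong to \<open>V(x)\<close> and \<open>P\<close> is negative: in the parallelogram with vertices
  \<open>x\<close>, \<open>x \<oplus> f\<close>, \<open>x \<oplus> g\<close>, \<open>x \<oplus> e\<close>, the sum of the values of \<open>u\<close> at the ends of the diagonal from \<open>x\<close> to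
  \<open>x \<oplus> e\<close> is smaller than at the ends of the other one.

  Leaves of the second kind behave like edges of a Delaunay triangulation for \<open>u\<close>, but no
  triangulation has to be constructed. Among all segments between points of \<open>X\<close> that have
  the same midpoint as such a leaf, the leaf has the lowest sum of values at its ends, for
  otherwise convexity forces a child of \<open>e\<close> into \<open>V(x)\<close> (\<open>crossing_diagonal\<close>,
  \<open>steeper_diagonal\<close>, \<open>diagonal_leaf_lowest\<close>). So its midpoint determines the leaf up to
  orientation (\<open>diagonal_leaf_midpoint\<close>).

  These midpoints are midpoints of edges of unimodular triangles with vertices in \<open>X\<close>, and for a
  convex set of \<open>N\<close> lattice points there are at most \<open>6 N\<close> of those
  (\<open>card_triangle_edge_sums\<close>). To see this, order the vertices of a triangle as \<open>x < y < p\<close> by a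
  generic linear form and flip the edge from \<open>x\<close> to \<open>p\<close> as long as \<open>x + p - y\<close> is in the set. A
  triangle that admits no flip is determined by its middle vertex and its orientation.
\<close>

section \<open>Bases of the integer plane and parents\<close>

definition cross :: "zvec \<Rightarrow> zvec \<Rightarrow> int" where
  "cross f g = fst f * snd g - snd f * fst g"

definition dot :: "zvec \<Rightarrow> zvec \<Rightarrow> int" where
  "dot f g = fst f * fst g + snd f * snd g"

text \<open>The point with integer coordinates \<open>(a, b)\<close> in the affine frame with origin \<open>z\<close> and axes
  \<open>f\<close>, \<open>g\<close>. All planar arguments below take place in the frame of a unimodular basis, where
  they become statements about the unit square.\<close>

definition frame_point :: "zvec \<Rightarrow> zvec \<Rightarrow> zvec \<Rightarrow> int \<Rightarrow> int \<Rightarrow> zvec" where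
  "frame_point z f g a b = (fst z + a * fst f + b * fst g, snd z + a * snd f + b * snd g)"

lemma frame_point_simps:
  "frame_point z f g 0 0 = z" "frame_point z f g 1 0 = z + f" "frame_point z f g 0 1 = z + g"
  "frame_point z f g 1 1 = z + (f + g)" "frame_point z f g 1 2 = z + (f + g + g)"
  by (auto simp: frame_point_def prod_eq_iff)

text \<open>Cramer's rule; for \<open>s = \<plusminus>1\<close> the division by the determinant is a multiplication by \<open>s\<close>.\<close>

lemma frame_point_cross:
  assumes "cross f g = s" "\<bar>s\<bar> = 1"
  shows "z + v = frame_point z f g (s * cross v g) (s * cross f v)"
proof -
  have s: "s * s = 1" using assms(2) by (metis abs_mult_self_eq mult_1)
  have "s * cross v g * fst f + s * cross f v * fst g = s * cross f g * fst v"
       "s * cross v g * snd f + s * cross f v * snd g = s * cross f g * snd v"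
    by (simp_all add: cross_def algebra_simps)
  then show ?thesis using s assms(1) by (simp add: frame_point_def prod_eq_iff)
qed

lemma lagrange_identity: "(dot f g)\<^sup>2 + (cross f g)\<^sup>2 = dot f f * dot g g"
  by (simp add: dot_def cross_def power2_eq_square algebra_simps)

lemma dot_self_nonneg: "dot f f \<ge> 0"
  by (simp add: dot_def)

lemma inner_rvec: "rvec f \<bullet> rvec g = real_of_int (dot f g)"
  by (simp add: rvec_def dot_def)

lemma norm_rvec_gt_1: "norm (rvec e) > 1 \<longleftrightarrow> dot e e > 1"
proof -
  have "norm (rvec e) > 1 \<longleftrightarrow> rvec e \<bullet> rvec e > 1"
    by (simp add: norm_eq_sqrt_inner)
  then show ?thesis by (simp add: inner_rvec)
qed

lemma irred_of_cross: assumes "cross f g = 1" shows "irred f" "irred g"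
proof -
  have 1: "gcd (fst f) (snd f) dvd cross f g" "gcd (fst g) (snd g) dvd cross f g"
    by (simp_all add: cross_def)
  then show "irred f" "irred g"  using assms by (simp_all add: irred_def)
qed

lemma dot_self_pos: assumes "cross f g = 1" shows "dot f f \<ge> 1" "dot g g \<ge> 1"
proof -
  have "dot f f * dot g g > 0"
    unfolding lagrange_identity[symmetric] assms by (simp add: add_nonneg_pos)
  then show "dot f f \<ge> 1" "dot g g \<ge> 1"
    using dot_self_nonneg[of f] dot_self_nonneg[of g] by (simp_all add: zero_less_mult_iff)
qed

lemma dot_add: "dot (f + g) v = dot f v + dot g v" "dot v (f + g) = dot v f + dot v g"
  and dot_commute: "dot f g = dot g f"
  by (simp_all add: dot_def algebra_simps)

text \<open>A common divisor of the coordinates of \<open>e\<close> divides \<open>det (f, e) = det (f, g) = 1\<close>, and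
  \<open>\<parallel>e\<parallel>\<^sup>2 \<ge> \<parallel>f\<parallel>\<^sup>2 + \<parallel>g\<parallel>\<^sup>2 \<ge> 2\<close> for an acute basis. So a direct acute basis always has an
  irreducible sum of norm above 1.\<close>

lemma has_parents_iff:
  "has_parents e f g \<longleftrightarrow> cross f g = 1 \<and> dot f g \<ge> 0 \<and> e = f + g"
proof (intro iffI)
  assume "has_parents e f g"
  then show "cross f g = 1 \<and> dot f g \<ge> 0 \<and> e = f + g"
    by (simp add: has_parents_def direct_acute_basis_def cross_def inner_rvec)
next
  assume a: "cross f g = 1 \<and> dot f g \<ge> 0 \<and> e = f + g"
  then have "cross f e = 1" by (simp add: cross_def algebra_simps)
  then have "irred e" by (rule irred_of_cross)
  moreover have "dot e e > 1" using dot_self_pos[of f g] a by (simp add: dot_add dot_commute[of g f])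
  ultimately show "has_parents e f g" using a
    by (simp add: has_parents_def direct_acute_basis_def cross_def inner_rvec norm_rvec_gt_1)
qed

lemma has_parents_add:
  assumes "has_parents e f g"
  shows "has_parents (e + g) e g" "has_parents (e + f) f e"
proof -
  have "dot f f \<ge> 1" "dot g g \<ge> 1" using assms dot_self_pos[of f g] by (simp_all add: has_parents_iff)
  then show "has_parents (e + g) e g" "has_parents (e + f) f e"
    using assms by (auto simp: has_parents_iff dot_add cross_def algebra_simps dot_commute)
qed

text \<open>Two direct bases with the same sum \<open>e\<close> differ by \<open>f' = f + b e\<close>, \<open>g' = g - b e\<close> with an
  integer \<open>b\<close>. For \<open>b \<noteq> 0\<close> the term \<open>- b\<^sup>2 \<parallel>e\<parallel>\<^sup>2\<close> makes the inner product of \<open>f'\<close> and \<open>g'\<close>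
  negative.\<close>

lemma parents_unique:
  assumes "has_parents e f g" "has_parents e f' g'"
  shows "f' = f \<and> g' = g"
proof -
  define b where "b = cross f f'"
  have fg: "cross f g = 1" "dot f g \<ge> 0" "e = f + g" and fg': "cross f' g' = 1" "dot f' g' \<ge> 0" "e = f' + g'"
    using assms by (auto simp: has_parents_iff)
  have g': "g' = f + g - f'" using fg fg' by (metis add_diff_cancel_left')
  have a: "cross f' g = b + 1"
    using fg'(1) unfolding g' b_def by (simp add: cross_def algebra_simps)
  have "0 + f' = frame_point 0 f g (b + 1) b"
    using frame_point_cross[of f g 1 0 f'] fg(1) a b_def by simp
  then have f': "f' = (fst f + b * fst e, snd f + b * snd e)"
    by (simp add: frame_point_def fg(3) algebra_simps)
  define Q where "Q = b * b * (dot f f + dot g g + 2 * dot f g)"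
  have k: "dot f' g' = dot f g + b * dot g g - b * dot f f - Q"
    unfolding g' f' fg(3) Q_def by (simp add: dot_def algebra_simps)
  have p: "dot f f \<ge> 1" "dot g g \<ge> 1" using dot_self_pos fg(1) by auto
  have "b = 0"
  proof (rule ccontr)
    assume "b \<noteq> 0"
    have h: "\<bar>b\<bar> * (dot f f + dot g g + 2 * dot f g) \<le> Q"
      unfolding Q_def
    proof (rule mult_right_mono)
      show "\<bar>b\<bar> \<le> b * b" using \<open>b \<noteq> 0\<close> self_le_power[of "\<bar>b\<bar>" 2] by (simp add: power2_eq_square)
    qed (use p fg in simp)
    have j: "dot f g \<le> \<bar>b\<bar> * dot f g" "1 \<le> \<bar>b\<bar> * dot f f" "1 \<le> \<bar>b\<bar> * dot g g"
      using \<open>b \<noteq> 0\<close> fg p mult_mono[of 1 "\<bar>b\<bar>" 1 "dot f f"] mult_mono[of 1 "\<bar>b\<bar>" 1 "dot g g"]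
        mult_right_mono[of 1 "\<bar>b\<bar>" "dot f g"] by auto
    have "dot f' g' < 0"
      using h j fg(2) unfolding k distrib_left
      by (cases "b > 0") (auto simp: abs_of_pos abs_of_nonpos)
    then show False using fg' by simp
  qed
  then show ?thesis using f' g' fg by (simp add: prod_eq_iff)
qed

text \<open>The products \<open>x = f\<^sub>1 g\<^sub>2\<close> and \<open>y = f\<^sub>2 g\<^sub>1\<close> are integers with \<open>x - y = 1\<close>, hence \<open>x y \<ge> 0\<close>.
  So \<open>f\<^sub>1 g\<^sub>1\<close> and \<open>f\<^sub>2 g\<^sub>2\<close> have a nonnegative product, and a nonnegative sum by acuteness.
  In consequence the \<open>l\<^sub>1\<close> norm is additive on parents.\<close>

lemma acute_basis_same_quadrant:
  assumes "cross f g = 1" "dot f g \<ge> 0"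
  shows "fst f * fst g \<ge> 0" "snd f * snd g \<ge> 0"
proof -
  let ?p = "fst f * snd g" and ?q = "snd f * fst g"
  have pq: "?p - ?q = 1" using assms by (simp add: cross_def)
  have e: "?p * ?q = (fst f * fst g) * (snd f * snd g)" by simp
  have "x * y \<ge> 0" if "x - y = 1" for x y :: int
    using that by (cases "y \<ge> 0") (auto simp: zero_le_mult_iff)
  from this[OF pq] show "fst f * fst g \<ge> 0" "snd f * snd g \<ge> 0"
    using assms(2) unfolding e dot_def zero_le_mult_iff[of "fst f * fst g"] by linarith+
qed

definition l1 :: "zvec \<Rightarrow> nat" where "l1 e = nat (\<bar>fst e\<bar> + \<bar>snd e\<bar>)"

lemma l1_parents:
  assumes "has_parents e f g" shows "l1 e = l1 f + l1 g" "l1 f > 0" "l1 g > 0"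
proof -
  have fg: "cross f g = 1" "dot f g \<ge> 0" "e = f + g" using assms by (auto simp: has_parents_iff)
  have "\<bar>fst e\<bar> = \<bar>fst f\<bar> + \<bar>fst g\<bar>" "\<bar>snd e\<bar> = \<bar>snd f\<bar> + \<bar>snd g\<bar>"
    using acute_basis_same_quadrant[OF fg(1,2)] by (auto simp: fg(3) zero_le_mult_iff)
  then show "l1 e = l1 f + l1 g" by (simp add: l1_def nat_add_distrib)
  have "l1 v > 0" if "dot v v \<ge> 1" for v
  proof -
    have "fst v \<noteq> 0 \<or> snd v \<noteq> 0" using that by (auto simp: dot_def)
    then show ?thesis by (auto simp: l1_def)
  qed
  then show "l1 f > 0" "l1 g > 0" using dot_self_pos[OF fg(1)] by auto
qed

text \<open>The subtractive Euclidean algorithm. Put \<open>k = \<langle>f, g\<rangle>\<close>. If \<open>k \<ge> \<parallel>g\<parallel>\<^sup>2\<close> or \<open>k \<ge> \<parallel>f\<parallel>\<^sup>2\<close> then one vector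
  can be subtracted from the other while the basis stays acute. Otherwise
  \<open>(k + 1)\<^sup>2 \<le> \<parallel>f\<parallel>\<^sup>2 \<parallel>g\<parallel>\<^sup>2 = k\<^sup>2 + 1\<close> by Lagrange's identity, which forces \<open>k = 0\<close> and two unit vectors.\<close>

lemma acute_basis_cases:
  assumes "cross f g = 1" "dot f g \<ge> 0"
  obtains "has_parents f (f - g) g" | "has_parents g f (g - f)" | "dot f f = 1" "dot g g = 1"
proof -
  let ?k = "dot f g"
  consider "?k \<ge> dot g g" | "?k \<ge> dot f f" | "dot f f \<ge> ?k + 1" "dot g g \<ge> ?k + 1" by linarith
  then show thesis
  proof cases
    case 1
    then have "has_parents f (f - g) g"
      using assms by (simp add: has_parents_iff dot_def cross_def algebra_simps)
    then show thesis by (rule that)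
  next
    case 2
    then have "has_parents g f (g - f)"
      using assms by (simp add: has_parents_iff dot_def cross_def algebra_simps)
    then show thesis by (rule that)
  next
    case 3
    then have "(?k + 1) * (?k + 1) \<le> dot f f * dot g g" using assms by (intro mult_mono) auto
    also have "\<dots> = ?k * ?k + 1" using lagrange_identity[of f g] assms by (simp add: power2_eq_square)
    finally have k: "?k = 0" using assms by (simp add: algebra_simps)
    then have "dot f f * dot g g = 1" using lagrange_identity[of f g] assms by simp
    then show thesis using 3 k dot_self_nonneg by (intro that) (auto simp: zmult_eq_1_iff)
  qed
qed

lemma no_parents_unit: "dot e e = 1 \<Longrightarrow> \<not> is_parent f e"
  by (auto simp: is_parent_def has_parents_def norm_rvec_gt_1)

text \<open>One of the parents of \<open>e\<close> is a parent of the other one, unless both are unit vectors. So the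
  ancestors form a chain, up to the unit vectors at its end: the ancestors of \<open>e\<close> are \<open>e\<close> and
  those of its larger parent, and the \<open>l\<^sub>1\<close> norm drops at each step.\<close>

lemma few_ancestors:
  "\<exists>A. finite A \<and> e \<in> A \<and> (\<forall>a\<in>A. \<forall>f. is_parent f a \<longrightarrow> f \<in> A) \<and> card A \<le> l1 e + 1"
proof (induction "l1 e" arbitrary: e rule: less_induct)
  case less
  show ?case
  proof (cases "\<exists>f g. has_parents e f g")
    case False
    then show ?thesis by (intro exI[of _ "{e}"]) (auto simp: is_parent_def)
  next
    case True
    then obtain f g where p: "has_parents e f g" by blast
    have par: "v = f \<or> v = g" if "is_parent v e" for v
      using that parents_unique[OF p] unfolding is_parent_def by blast
    have l: "l1 f < l1 e" "l1 g < l1 e" using l1_parents[OF p] by auto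
    have step: ?thesis if v: "l1 v < l1 e" and fgv: "(v = f \<and> is_parent g v) \<or> (v = g \<and> is_parent f v)" for v
    proof -
      obtain A where A: "finite A" "v \<in> A" "\<forall>a\<in>A. \<forall>f. is_parent f a \<longrightarrow> f \<in> A" "card A \<le> l1 v + 1"
        using less[OF v] by blast
      have "f \<in> A" "g \<in> A" using A(2,3) fgv by blast+
      then show ?thesis using A v par
        by (intro exI[of _ "insert e A"]) (auto simp: card_insert_if)
    qed
    show ?thesis
    proof (rule acute_basis_cases)
      show "cross f g = 1" "0 \<le> dot f g" using p by (auto simp: has_parents_iff)
    next
      assume "has_parents f (f - g) g"
      then show ?thesis using l by (intro step[of f]) (unfold is_parent_def, blast+)
    next
      assume "has_parents g f (g - f)"
      then show ?thesis using l by (intro step[of g]) (unfold is_parent_def, blast+)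
    next
      assume u: "dot f f = 1" "dot g g = 1"
      have "card {e, f, g} \<le> 3" by (rule card_insert_le_m1) (auto simp: card_insert_if)
      then show ?thesis using l1_parents[OF p] par no_parents_unit[OF u(1)] no_parents_unit[OF u(2)]
        by (intro exI[of _ "{e, f, g}"]) auto
    qed
  qed
qed

section \<open>Convex sets of lattice points and unimodular triangles\<close>

text \<open>The traces on the integer lattice of a convex set and of a convex function on it. Convex
  combinations are cleared of denominators, so that the weights are integers, and three points
  are enough for every argument below.\<close>

locale lattice_convex =
  fixes Z :: "zvec set" and w :: "zvec \<Rightarrow> real"
  assumes fin: "finite Z"
    and weighted: "\<And>z z1 z2 z3 (a::int) b c.
      z1 \<in> Z \<Longrightarrow> z2 \<in> Z \<Longrightarrow> z3 \<in> Z \<Longrightarrow> 0 \<le> a \<Longrightarrow> 0 \<le> b \<Longrightarrow> 0 \<le> c \<Longrightarrow> 0 < a + b + c \<Longrightarrow>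
      (a + b + c) * fst z = a * fst z1 + b * fst z2 + c * fst z3 \<Longrightarrow>
      (a + b + c) * snd z = a * snd z1 + b * snd z2 + c * snd z3 \<Longrightarrow>
      z \<in> Z \<and> of_int (a + b + c) * w z \<le> of_int a * w z1 + of_int b * w z2 + of_int c * w z3"
begin

lemma frame_weighted:
  assumes Z: "frame_point z f g A1 B1 \<in> Z" "frame_point z f g A2 B2 \<in> Z" "frame_point z f g A3 B3 \<in> Z"
    and abc: "0 \<le> a" "0 \<le> b" "0 \<le> c" "0 < a + b + c"
    and A: "(a + b + c) * A0 = a * A1 + b * A2 + c * A3"
    and B: "(a + b + c) * B0 = a * B1 + b * B2 + c * B3"
  shows "frame_point z f g A0 B0 \<in> Z"
    and "of_int (a + b + c) * w (frame_point z f g A0 B0) \<le>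
      of_int a * w (frame_point z f g A1 B1) + of_int b * w (frame_point z f g A2 B2)
      + of_int c * w (frame_point z f g A3 B3)"
proof -
  have *: "(a + b + c) * (t + A0 * p + B0 * q) =
      a * (t + A1 * p + B1 * q) + b * (t + A2 * p + B2 * q) + c * (t + A3 * p + B3 * q)" for t p q
  proof -
    have "(a + b + c) * (t + A0 * p + B0 * q)
        = (a + b + c) * t + ((a + b + c) * A0) * p + ((a + b + c) * B0) * q"
      by (simp add: distrib_left mult.assoc)
    also have "\<dots> = a * (t + A1 * p + B1 * q) + b * (t + A2 * p + B2 * q) + c * (t + A3 * p + B3 * q)"
      unfolding A B by (simp add: algebra_simps)
    finally show ?thesis .
  qed
  have "frame_point z f g A0 B0 \<in> Z \<and> of_int (a + b + c) * w (frame_point z f g A0 B0) \<le>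
      of_int a * w (frame_point z f g A1 B1) + of_int b * w (frame_point z f g A2 B2)
      + of_int c * w (frame_point z f g A3 B3)"
    by (rule weighted[OF Z abc]) (simp_all add: frame_point_def *)
  then show "frame_point z f g A0 B0 \<in> Z"
    and "of_int (a + b + c) * w (frame_point z f g A0 B0) \<le>
      of_int a * w (frame_point z f g A1 B1) + of_int b * w (frame_point z f g A2 B2)
      + of_int c * w (frame_point z f g A3 B3)" by auto
qed

text \<open>In the frame \<open>(z, f, g)\<close> consider the unit square and a segment with the same centre, from
  \<open>(A, B)\<close> to \<open>(1 - A, 1 - B)\<close>, where \<open>A \<ge> 1\<close> and \<open>B \<le> 0\<close>. The corner \<open>(1, 0)\<close> lies in the
  triangle \<open>(A, B), (1, 1), (0, 0)\<close> and \<open>(0, 1)\<close> in the opposite one. So if the sum of values at the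
  ends of the segment is at most that of the diagonal \<open>(0, 0), (1, 1)\<close>, the same is true for
  the diagonal \<open>(1, 0), (0, 1)\<close>. Hence a diagonal that is lower than the other one of its square
  can be undercut only from within the cone of \<open>f\<close> and \<open>g\<close>.\<close>

lemma crossing_diagonal:
  assumes Z: "z \<in> Z" "z + (f + g) \<in> Z"
      "frame_point z f g A B \<in> Z" "frame_point z f g (1 - A) (1 - B) \<in> Z"
    and AB: "A \<ge> 1" "B \<le> 0"
    and le: "w (frame_point z f g A B) + w (frame_point z f g (1 - A) (1 - B)) \<le> w z + w (z + (f + g))"
  shows "w (z + f) + w (z + g) \<le> w z + w (z + (f + g))"
proof -
  have Z': "frame_point z f g 0 0 \<in> Z" "frame_point z f g 1 1 \<in> Z"
      "frame_point z f g A B \<in> Z" "frame_point z f g (1 - A) (1 - B) \<in> Z"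
    using Z by (simp_all add: frame_point_simps)
  have 1: "of_int (1 + (-B) + (A - 1)) * w (frame_point z f g 1 0) \<le>
     of_int 1 * w (frame_point z f g A B) + of_int (-B) * w (frame_point z f g 1 1)
     + of_int (A - 1) * w (frame_point z f g 0 0)"
    by (rule frame_weighted) (use Z' AB in \<open>auto simp: algebra_simps\<close>)
  have 2: "of_int (1 + (-B) + (A - 1)) * w (frame_point z f g 0 1) \<le>
     of_int 1 * w (frame_point z f g (1 - A) (1 - B)) + of_int (-B) * w (frame_point z f g 0 0)
     + of_int (A - 1) * w (frame_point z f g 1 1)"
    by (rule frame_weighted) (use Z' AB in \<open>auto simp: algebra_simps\<close>)
  have "of_int (A - B) * (w (z + f) + w (z + g)) \<le> of_int (A - B) * (w z + w (z + (f + g)))"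
    using 1 2 le unfolding frame_point_simps by (simp add: algebra_simps)
  moreover have "of_int (A - B) > (0::real)" using AB by simp
  ultimately show ?thesis by (simp only: mult_le_cancel_left_pos)
qed

text \<open>The remaining segments, with \<open>A, B \<ge> 1\<close>. If such a segment with \<open>B > A\<close> undercuts the diagonal
  of the unit square, then \<open>(1, 2)\<close> belongs to the set, and the diagonal from
  \<open>(0, 0)\<close> to \<open>(1, 2)\<close> is lower than the one from \<open>(0, 1)\<close> to \<open>(1, 1)\<close>: the stencil would have been
  refined further. The two inequalities express that \<open>(1, 2)\<close> lies in the triangle
  \<open>(A, B), (0, 1), (1, 1)\<close> and \<open>(0, 0)\<close> in the triangle \<open>(1 - A, 1 - B), (0, 1), (1, 1)\<close>.\<close>

lemma steeper_diagonal:
  assumes Z: "z \<in> Z" "z + g \<in> Z" "z + (f + g) \<in> Z"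
      "frame_point z f g A B \<in> Z" "frame_point z f g (1 - A) (1 - B) \<in> Z"
    and AB: "A \<ge> 1" "B > A"
    and less: "w (frame_point z f g A B) + w (frame_point z f g (1 - A) (1 - B)) < w z + w (z + (f + g))"
  shows "z + (f + g + g) \<in> Z" "w (z + (f + g + g)) + w z < w (z + (f + g)) + w (z + g)"
proof -
  have Z': "frame_point z f g 0 1 \<in> Z" "frame_point z f g 1 1 \<in> Z"
      "frame_point z f g A B \<in> Z" "frame_point z f g (1 - A) (1 - B) \<in> Z"
    using Z by (simp_all add: frame_point_simps)
  have 0: "frame_point z f g 1 2 \<in> Z"
    by (rule frame_weighted(1)[of z f g A B 0 1 1 1 1 "A - 1" "B - 1 - A"])
      (use Z' AB in \<open>auto simp: algebra_simps\<close>)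
  have 1: "of_int (1 + (A - 1) + (B - 1 - A)) * w (frame_point z f g 1 2) \<le>
     of_int 1 * w (frame_point z f g A B) + of_int (A - 1) * w (frame_point z f g 0 1)
     + of_int (B - 1 - A) * w (frame_point z f g 1 1)"
    by (rule frame_weighted) (use Z' AB in \<open>auto simp: algebra_simps\<close>)
  have 2: "of_int (1 + (B - A) + (A - 1)) * w (frame_point z f g 0 0) \<le>
     of_int 1 * w (frame_point z f g (1 - A) (1 - B)) + of_int (B - A) * w (frame_point z f g 0 1)
     + of_int (A - 1) * w (frame_point z f g 1 1)"
    by (rule frame_weighted) (use Z' AB in \<open>auto simp: algebra_simps\<close>)
  show "z + (f + g + g) \<in> Z" using 0 by (simp only: frame_point_simps)
  have "of_int (B - 1) * (w (z + (f + g + g)) + w z) < of_int (B - 1) * (w (z + (f + g)) + w (z + g))"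
    using 1 2 less unfolding frame_point_simps by (simp add: algebra_simps)
  moreover have "of_int (B - 1) > (0::real)" using AB by simp
  ultimately show "w (z + (f + g + g)) + w z < w (z + (f + g)) + w (z + g)"
    by (simp only: mult_less_cancel_left_pos)
qed

text \<open>The corner \<open>(1, 1)\<close> is in the convex hull of \<open>(0, 0)\<close>, \<open>(1, 0)\<close>, \<open>(0, 1)\<close> and any point \<open>(a, b)\<close>
  with positive integer coordinates.\<close>

lemma unit_corner_in:
  assumes "frame_point z f g 0 0 \<in> Z" "frame_point z f g 1 0 \<in> Z" "frame_point z f g 0 1 \<in> Z"
    "frame_point z f g a b \<in> Z" "a \<ge> 1" "b \<ge> 1"
  shows "z + (f + g) \<in> Z"
proof (cases "a \<ge> b")
  case True
  have "frame_point z f g 1 1 \<in> Z"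
    by (rule frame_weighted(1)[of z f g a b 0 1 0 0 1 "a - b" "b - 1"])
      (use assms True in \<open>auto simp: algebra_simps\<close>)
  then show ?thesis by (simp only: frame_point_simps)
next
  case False
  have "frame_point z f g 1 1 \<in> Z"
    by (rule frame_weighted(1)[of z f g a b 1 0 0 0 1 "b - a" "a - 1"])
      (use assms False in \<open>auto simp: algebra_simps\<close>)
  then show ?thesis by (simp only: frame_point_simps)
qed

end

text \<open>A generic linear order on \<open>Z\<close>: for \<open>K\<close> larger than all differences of second coordinates this
  is the lexicographic order. An additive key makes signs of linear combinations easy to follow,
  and its integer values serve as a measure for induction.\<close>

lemma additive_injective_order:
  assumes "finite (Z :: zvec set)"
  obtains K :: int where "inj_on (\<lambda>z. K * fst z + snd z) Z"
proof -
  define K where "K = 1 + 2 * (\<Sum>z\<in>Z. \<bar>snd z\<bar>)"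
  have b: "\<bar>snd z\<bar> \<le> (\<Sum>z\<in>Z. \<bar>snd z\<bar>)" if "z \<in> Z" for z
    using assms that by (intro member_le_sum) auto
  have "inj_on (\<lambda>z. K * fst z + snd z) Z"
  proof (rule inj_onI)
    fix z z' assume z: "z \<in> Z" "z' \<in> Z" and eq: "K * fst z + snd z = K * fst z' + snd z'"
    have "K * (fst z - fst z') = snd z' - snd z" using eq by (simp add: algebra_simps)
    moreover have "\<bar>snd z' - snd z\<bar> < K" using b[OF z(1)] b[OF z(2)] by (simp add: K_def)
    ultimately have "\<bar>K\<bar> * \<bar>fst z - fst z'\<bar> < K * 1" by (metis abs_mult mult.right_neutral)
    moreover have "K > 0" by (simp add: K_def add_pos_nonneg sum_nonneg)
    ultimately have "fst z = fst z'" by simp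
    then show "z = z'" using eq by (simp add: prod_eq_iff)
  qed
  then show thesis by (rule that)
qed

context lattice_convex
begin

text \<open>Unimodular triangles with vertices \<open>x < y < p\<close> whose longest edge cannot be flipped, as the
  fourth vertex \<open>x + p - y\<close> of the parallelogram is not available.\<close>

definition unflippable :: "int \<Rightarrow> (zvec \<times> zvec \<times> zvec) set" where
  "unflippable K = {(x, y, p). x \<in> Z \<and> y \<in> Z \<and> p \<in> Z \<and>
     K * fst x + snd x < K * fst y + snd y \<and> K * fst y + snd y < K * fst p + snd p \<and>
     \<bar>cross (x - y) (p - y)\<bar> = 1 \<and> x + p - y \<notin> Z}"

text \<open>An unflippable triangle is determined by its middle vertex \<open>y\<close> and its orientation. For two of
  them, let \<open>q, q'\<close> and \<open>r, r'\<close> be the edges from \<open>y\<close> upwards and downwards in the order. If an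
  edge of one triangle pointed strictly inside the angle of the other, then the fourth vertex of
  the parallelogram would be in \<open>Z\<close> by \<open>unit_corner_in\<close>. Both angles contain the
  direction on which the order form vanishes, with the sign given by the orientation. So they
  overlap, and thus they coincide.\<close>

lemma unflippable_unique:
  assumes t: "(x, y, p) \<in> unflippable K" and t': "(x', y, p') \<in> unflippable K"
    and same: "cross (x - y) (p - y) = cross (x' - y) (p' - y)"
  shows "x' = x \<and> p' = p"
proof -
  define q r q' r' where defs: "q = p - y" "r = x - y" "q' = p' - y" "r' = x' - y"
  define s where "s = cross q r"
  have s: "cross q r = s" "cross q' r' = s" "\<bar>s\<bar> = 1"
    using t same by (auto simp: s_def defs unflippable_def cross_def algebra_simps)
  then have ss: "s * s = 1" by (metis abs_mult_self_eq mult_1)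
  \<comment> \<open>The matrix with rows \<open>(a, b)\<close>, \<open>(c, d)\<close> takes \<open>(q, r)\<close> to \<open>(q', r')\<close> and has determinant 1.\<close>
  define a b c d where abcd: "a = s * cross q' r" "b = s * cross q q'"
    "c = s * cross r' r" "d = s * cross q r'"
  have q': "y + q' = frame_point y q r a b" and r': "y + r' = frame_point y q r c d"
    using frame_point_cross[OF s(1,3)] by (auto simp: abcd)
  have "s * cross q r' = d" "s * cross q' q = - b" "s * cross r r' = - c" "s * cross q' r = a"
    by (simp_all add: abcd cross_def algebra_simps)
  then have q: "y + q = frame_point y q' r' d (- b)" and r: "y + r = frame_point y q' r' (- c) a"
    using frame_point_cross[OF s(2,3), of y q] frame_point_cross[OF s(2,3), of y r] by simp_all
  have Z: "y \<in> Z" "y + q \<in> Z" "y + r \<in> Z" "y + q' \<in> Z" "y + r' \<in> Z"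
    using t t' by (auto simp: unflippable_def defs)
  have nZ: "y + (q + r) \<notin> Z" "y + (q' + r') \<notin> Z"
    using t t' by (auto simp: unflippable_def defs algebra_simps)
  have "frame_point y q r 0 0 \<in> Z" "frame_point y q r 1 0 \<in> Z" "frame_point y q r 0 1 \<in> Z"
    "frame_point y q' r' 0 0 \<in> Z" "frame_point y q' r' 1 0 \<in> Z" "frame_point y q' r' 0 1 \<in> Z"
    using Z by (simp_all add: frame_point_simps)
  then have no_corner: "\<not> (a \<ge> 1 \<and> b \<ge> 1)" "\<not> (c \<ge> 1 \<and> d \<ge> 1)" "\<not> (d \<ge> 1 \<and> -b \<ge> 1)" "\<not> (-c \<ge> 1 \<and> a \<ge> 1)"
    using unit_corner_in[of y q r a b] unit_corner_in[of y q r c d] unit_corner_in[of y q' r' d "-b"]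
      unit_corner_in[of y q' r' "-c" a] Z nZ q' r' q r by auto
  define L where "L z = K * fst z + snd z" for z :: zvec
  have sgn: "L q > 0" "L q' > 0" "L r < 0" "L r' < 0"
    using t t' by (auto simp: unflippable_def defs L_def algebra_simps)
  have Lframe: "L v = i * L k + j * L l" if "y + v = frame_point y k l i j" for v k l i j
    using that by (simp add: L_def frame_point_def prod_eq_iff algebra_simps)
  have Lq': "L q' = a * L q + b * L r" and Lr': "L r' = c * L q + d * L r"
    by (rule Lframe[OF q'], rule Lframe[OF r'])
  have Lq: "L q = d * L q' - b * L r'" using Lframe[OF q] by linarith
  have "\<not> (a \<le> 0 \<and> b \<ge> 0)"
  proof
    assume "a \<le> 0 \<and> b \<ge> 0"
    then have "a * L q \<le> 0" "b * L r \<le> 0" using sgn by (simp_all add: mult_le_0_iff)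
    then show False using Lq' sgn by linarith
  qed
  moreover have "\<not> (c \<ge> 0 \<and> d \<le> 0)"
  proof
    assume "c \<ge> 0 \<and> d \<le> 0"
    then have "c * L q \<ge> 0" "d * L r \<ge> 0" using sgn by (simp_all add: zero_le_mult_iff)
    then show False using Lr' sgn by linarith
  qed
  moreover have "\<not> (d \<le> 0 \<and> b \<le> 0)"
  proof
    assume "d \<le> 0 \<and> b \<le> 0"
    then have "d * L q' \<le> 0" "b * L r' \<ge> 0" using sgn by (simp_all add: mult_le_0_iff zero_le_mult_iff)
    then show False using Lq sgn by linarith
  qed
  ultimately have "a \<ge> 1 \<and> b = 0 \<and> c = 0 \<and> d \<ge> 1" using no_corner by presburger
  then have a: "a \<ge> 1" "b = 0" "c = 0" "d \<ge> 1" by auto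
  have "s = cross (y + q' - y) (y + r' - y)" using s(2) by simp
  also have "\<dots> = a * d * s"
    unfolding q' r' using a s(1) by (simp add: frame_point_def cross_def algebra_simps)
  finally have "a * d = 1" using s(3) by auto
  then have "a = 1" "d = 1" using a by (auto simp: zmult_eq_1_iff)
  then have "y + q' = y + q" "y + r' = y + r" using q' r' a by (auto simp: frame_point_simps)
  then show ?thesis by (simp add: defs)
qed

lemma card_unflippable: "finite (unflippable K) \<and> card (unflippable K) \<le> 2 * card Z"
proof -
  have "inj_on (\<lambda>(x, y, p). (y, cross (x - y) (p - y))) (unflippable K)"
    using unflippable_unique by (fastforce intro!: inj_onI)
  moreover have "(\<lambda>(x, y, p). (y, cross (x - y) (p - y))) ` unflippable K \<subseteq> Z \<times> {1, -1}"
    by (auto simp: unflippable_def)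
  moreover have "finite (Z \<times> {1, -1 :: int})" "card (Z \<times> {1, -1 :: int}) = 2 * card Z"
    using fin by (auto simp: card_cartesian_product)
  ultimately show ?thesis by (metis (no_types, lifting) card_inj_on_le inj_on_finite)
qed

definition edge_sums :: "zvec \<times> zvec \<times> zvec \<Rightarrow> zvec set" where
  "edge_sums = (\<lambda>(x, y, p). {x + y, y + p, x + p})"

text \<open>Replace a flippable triangle by one of the two halves of its parallelogram that are cut off by
  the other diagonal. A half can be chosen that still has an edge with midpoint \<open>m / 2\<close>, because
  both diagonals have the same midpoint. Its extent in the order is smaller, so flipping ends.\<close>

lemma edge_of_unflippable_triangle:
  assumes inj: "inj_on (\<lambda>z. K * fst z + snd z) Z"
    and "x \<in> Z" "y \<in> Z" "p \<in> Z" "\<bar>cross (x - y) (p - y)\<bar> = 1"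
    and "K * fst x + snd x < K * fst y + snd y" "K * fst y + snd y < K * fst p + snd p"
    and "m \<in> {x + y, y + p, x + p}"
  shows "\<exists>t \<in> unflippable K. m \<in> edge_sums t"
  using assms(2-)
proof (induction "nat ((K * fst p + snd p) - (K * fst x + snd x))" arbitrary: x y p rule: less_induct)
  case less
  define L where "L z = K * fst z + snd z" for z :: zvec
  note prems = less.prems[folded L_def]
  note IH = less.hyps[folded L_def]
  \<comment> \<open>The fourth vertex; \<open>L v\<close> lies strictly between \<open>L x\<close> and \<open>L p\<close>.\<close>
  define v where "v = x + p - y"
  show ?case
  proof (cases "v \<in> Z")
    case False
    then have "(x, y, p) \<in> unflippable K" using less.prems by (simp add: unflippable_def v_def)
    moreover have "m \<in> edge_sums (x, y, p)" using less.prems by (simp add: edge_sums_def)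
    ultimately show ?thesis by blast
  next
    case True
    have Lv: "L v = L x + L p - L y" by (simp add: L_def v_def algebra_simps)
    have cr: "cross (x - y) (v - y) = cross (x - y) (p - y)" "cross (y - v) (p - v) = - cross (x - y) (p - y)"
      "cross (x - v) (y - v) = - cross (x - y) (p - y)" "cross (v - y) (p - y) = cross (x - y) (p - y)"
      by (simp_all add: v_def cross_def algebra_simps)
    have "v \<noteq> y" using cr prems(4) by (auto simp: cross_def)
    then have "L v \<noteq> L y" using inj True prems(2) by (auto simp: L_def inj_on_def)
    moreover have m: "m \<in> {x + y, y + v, x + v} \<or> m \<in> {y + v, v + p, y + p}"
      using prems(7) by (auto simp: v_def)
    moreover have "{x + y, y + v, x + v} = {x + v, v + y, x + y}" "{y + v, v + p, y + p} = {v + y, y + p, v + p}"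
      by (auto simp: add.commute)
    ultimately consider
        "L v < L y" "m \<in> {x + v, v + y, x + y}" | "L y < L v" "m \<in> {x + y, y + v, x + v}"
      | "L v < L y" "m \<in> {v + y, y + p, v + p}" | "L y < L v" "m \<in> {y + v, v + p, y + p}"
      by (metis linorder_neqE_linordered_idom)
    then show ?thesis
    proof cases
      case 1
      then show ?thesis using prems True Lv cr by (intro IH[of y x v]) auto
    next
      case 2
      then show ?thesis using prems True Lv cr by (intro IH[of v x y]) auto
    next
      case 3
      then show ?thesis using prems True Lv cr by (intro IH[of p v y]) auto
    next
      case 4
      then show ?thesis using prems True Lv cr by (intro IH[of p y v]) auto
    qed
  qed
qed

text \<open>Sums of the two endpoints of an edge, that is, midpoints scaled by 2.\<close>

definition triangle_edge_sums :: "zvec set" where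
  "triangle_edge_sums = {x + p |x y p. x \<in> Z \<and> y \<in> Z \<and> p \<in> Z \<and> \<bar>cross (x - y) (p - y)\<bar> = 1}"

text \<open>There are at most \<open>2 N\<close> unflippable triangles, and their \<open>3 \<cdot> 2 N\<close> edges provide all midpoints.\<close>

lemma card_triangle_edge_sums: "finite triangle_edge_sums \<and> card triangle_edge_sums \<le> 6 * card Z"
proof -
  obtain K where K: "inj_on (\<lambda>z. K * fst z + snd z) Z" using additive_injective_order[OF fin] by blast
  define L where "L z = K * fst z + snd z" for z :: zvec
  have "triangle_edge_sums \<subseteq> (\<Union>t\<in>unflippable K. edge_sums t)"
  proof
    fix m assume "m \<in> triangle_edge_sums"
    then obtain x y p where t: "x \<in> Z" "y \<in> Z" "p \<in> Z" "\<bar>cross (x - y) (p - y)\<bar> = 1" "m = x + p"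
      by (auto simp: triangle_edge_sums_def)
    have "x \<noteq> y" "y \<noteq> p" "x \<noteq> p" using t(4) by (auto simp: cross_def)
    then have ne: "L x \<noteq> L y" "L y \<noteq> L p" "L x \<noteq> L p" using K t by (auto simp: L_def inj_on_def)
    have cr: "\<bar>cross (y - x) (p - x)\<bar> = 1" "\<bar>cross (p - y) (x - y)\<bar> = 1" "\<bar>cross (p - x) (y - x)\<bar> = 1"
      "\<bar>cross (y - p) (x - p)\<bar> = 1" "\<bar>cross (x - p) (y - p)\<bar> = 1"
      using t(4) by (auto simp: cross_def algebra_simps abs_if split: if_splits)
    note F = edge_of_unflippable_triangle[OF K, folded L_def]
    have "\<exists>t \<in> unflippable K. m \<in> edge_sums t"
    proof -
      consider "L x < L y" "L y < L p" | "L y < L x" "L x < L p" | "L x < L p" "L p < L y"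
        | "L p < L x" "L x < L y" | "L p < L y" "L y < L x" | "L y < L p" "L p < L x"
        using ne by linarith
      then show ?thesis
      proof cases
        case 1 then show ?thesis using t cr by (intro F[of x y p]) auto
      next
        case 2 then show ?thesis using t cr by (intro F[of y x p]) auto
      next
        case 3 then show ?thesis using t cr by (intro F[of x p y]) auto
      next
        case 4 then show ?thesis using t cr by (intro F[of p x y]) (auto simp: add.commute)
      next
        case 5 then show ?thesis using t cr by (intro F[of p y x]) (auto simp: add.commute)
      next
        case 6 then show ?thesis using t cr by (intro F[of y p x]) (auto simp: add.commute)
      qed
    qed
    then show "m \<in> (\<Union>t\<in>unflippable K. edge_sums t)" by (auto simp: edge_sums_def)
  qed
  moreover have f: "finite (\<Union>t\<in>unflippable K. edge_sums t)" using card_unflippable by (auto simp: edge_sums_def)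
  ultimately have "finite triangle_edge_sums" "card triangle_edge_sums \<le> card (\<Union>t\<in>unflippable K. edge_sums t)"
    by (rule finite_subset, rule card_mono[rotated])
  note this(2)
  also have "card (\<Union>t\<in>unflippable K. edge_sums t) \<le> (\<Sum>t\<in>unflippable K. card (edge_sums t))"
    using card_unflippable by (intro card_UN_le) auto
  also have "\<dots> \<le> (\<Sum>t\<in>unflippable K. 3)"
    by (intro sum_mono) (auto simp: edge_sums_def card_insert_if)
  also have "\<dots> \<le> 6 * card Z" using card_unflippable[of K] by simp
  finally show ?thesis using \<open>finite triangle_edge_sums\<close> by simp
qed

end

section \<open>Counting the leaves of the stencils\<close>

text \<open>With \<open>p e\<^sub>1 + q e\<^sub>2 = 1\<close>, the vector \<open>e'\<close> is the integer multiple \<open>p e'\<^sub>1 + q e'\<^sub>2\<close> of \<open>e\<close>.\<close>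

lemma irred_parallel:
  assumes "irred e" "irred e'" "cross e e' = 0"
  shows "e' = e \<or> e' = - e"
proof -
  obtain p q where pq: "p * fst e + q * snd e = 1"
    using bezout_int[of "fst e" "snd e"] assms(1) by (auto simp: irred_def)
  define k where "k = p * fst e' + q * snd e'"
  have eq: "fst e * snd e' = snd e * fst e'" using assms(3) by (simp add: cross_def)
  have "k * fst e = (p * fst e + q * snd e) * fst e'" "k * snd e = (p * fst e + q * snd e) * snd e'"
    using eq unfolding k_def by algebra+
  then have e': "fst e' = k * fst e" "snd e' = k * snd e" by (simp_all add: pq)
  then have "k dvd 1" using assms(2) unfolding irred_def by (metis dvd_triv_left gcd_greatest)
  then have "k = 1 \<or> k = - 1" by (auto simp: zdvd1_eq abs_if split: if_splits)
  then show ?thesis using e' by (auto simp: prod_eq_iff)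
qed

lemma middle_ray_in_Cone:
  assumes "e1 \<in> A" "e3 \<in> A" "cross e1 e2 \<ge> 0" "cross e2 e3 \<ge> 0" "cross e1 e3 > 0"
  shows "rvec e2 \<in> Cone A"
proof -
  have cc: "convex_cone (Cone A)" by (simp add: Cone_def convex_cone_convex_cone_hull)
  have m: "rvec e1 \<in> Cone A" "rvec e3 \<in> Cone A"
    using assms(1,2) by (auto simp: Cone_def intro!: hull_inc)
  define s where "s = real_of_int (cross e1 e3)"
  have "cross e1 e3 * fst e2 = cross e2 e3 * fst e1 + cross e1 e2 * fst e3"
     "cross e1 e3 * snd e2 = cross e2 e3 * snd e1 + cross e1 e2 * snd e3"
    by (simp_all add: cross_def algebra_simps)
  then have "s * real_of_int (fst e2) = real_of_int (cross e2 e3) * real_of_int (fst e1) + real_of_int (cross e1 e2) * real_of_int (fst e3)"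
     "s * real_of_int (snd e2) = real_of_int (cross e2 e3) * real_of_int (snd e1) + real_of_int (cross e1 e2) * real_of_int (snd e3)"
    unfolding s_def by (metis of_int_add of_int_mult)+
  moreover have s: "s > 0" using assms by (simp add: s_def)
  ultimately have "rvec e2 = (cross e2 e3 / s) *\<^sub>R rvec e1 + (cross e1 e2 / s) *\<^sub>R rvec e3"
    by (simp add: rvec_def field_simps)
  moreover have "cross e2 e3 / s \<ge> 0" "cross e1 e2 / s \<ge> 0" using s assms by simp_all
  ultimately show ?thesis using cc m
    by (simp add: convex_cone_add convex_cone_scaleR)
qed

lemma Cone_Diff_eq:
  assumes "rvec e \<in> Cone (A - {e})" "e \<in> A" shows "Cone (A - {e}) = Cone A"
proof
  show "Cone (A - {e}) \<subseteq> Cone A" unfolding Cone_def by (intro hull_mono) auto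
  have "rvec v \<in> Cone (A - {e})" if "v \<in> A" for v
    using assms(1) that by (cases "v = e") (auto simp: Cone_def intro!: hull_inc)
  then have "rvec ` A \<subseteq> Cone (A - {e})" by blast
  then show "Cone A \<subseteq> Cone (A - {e})"
    unfolding Cone_def by (intro hull_minimal) (auto simp: convex_cone_convex_cone_hull)
qed

text \<open>The vectors that visibility protects from removal.\<close>

definition needed_rays :: "zvec set \<Rightarrow> zvec set" where
  "needed_rays A = {e \<in> A. Cone (A - {e}) \<noteq> Cone A}"

definition quadrant :: "int \<Rightarrow> int \<Rightarrow> zvec set" where
  "quadrant s t = {e. s * fst e \<ge> 0 \<and> t * snd e \<ge> 0}"

lemma cross_nonzero_in_quadrant:
  assumes "e \<in> quadrant s t" "e' \<in> quadrant s t" "irred e" "irred e'" "e \<noteq> e'" "\<bar>s\<bar> = 1" "\<bar>t\<bar> = 1"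
  shows "cross e e' \<noteq> 0"
proof
  assume "cross e e' = 0"
  then have e': "e' = - e" using irred_parallel assms by blast
  then have "s * fst e = 0" "t * snd e = 0" using assms by (auto simp: quadrant_def)
  then have "fst e = 0" "snd e = 0" using assms by auto
  then show False using assms by (simp add: irred_def)
qed

lemma cross_trans_in_quadrant:
  assumes "e1 \<in> quadrant s t" "e2 \<in> quadrant s t" "e3 \<in> quadrant s t" "\<bar>s\<bar> = 1" "\<bar>t\<bar> = 1"
    and "cross e1 e2 > 0" "cross e2 e3 > 0"
  shows "cross e1 e3 \<ge> 0"
proof -
  have e: "s * fst e2 * cross e1 e3 = s * fst e1 * cross e2 e3 + s * fst e3 * cross e1 e2"
    "t * snd e2 * cross e1 e3 = t * snd e1 * cross e2 e3 + t * snd e3 * cross e1 e2"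
    unfolding cross_def by algebra+
  have q: "s * fst e1 \<ge> 0" "t * snd e1 \<ge> 0" "s * fst e2 \<ge> 0" "t * snd e2 \<ge> 0" "s * fst e3 \<ge> 0" "t * snd e3 \<ge> 0"
    using assms(1-3) by (simp_all add: quadrant_def)
  have "s * fst e2 * cross e1 e3 \<ge> 0" "t * snd e2 * cross e1 e3 \<ge> 0"
    unfolding e using assms(6,7)
    by (auto intro!: add_nonneg_nonneg mult_nonneg_nonneg[OF q(1)] mult_nonneg_nonneg[OF q(2)]
        mult_nonneg_nonneg[OF q(5)] mult_nonneg_nonneg[OF q(6)])
  moreover have "s * fst e2 > 0 \<or> t * snd e2 > 0"
  proof (rule ccontr)
    assume "\<not> ?thesis"
    then have "s * fst e2 = 0" "t * snd e2 = 0" using q by linarith+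
    then have "fst e2 = 0" "snd e2 = 0" using assms(4,5) by auto
    then show False using assms(6) by (simp add: cross_def)
  qed
  ultimately show ?thesis by (metis zero_le_mult_iff linorder_not_less)
qed

text \<open>Among three directions in a quadrant, the middle one is in the cone of the other two.\<close>

lemma card_needed_rays_quadrant:
  assumes A: "\<forall>e\<in>A. irred e" and st: "\<bar>s\<bar> = 1" "\<bar>t\<bar> = 1"
  shows "card (needed_rays A \<inter> quadrant s t) \<le> 2"
proof (rule ccontr)
  assume "\<not> ?thesis"
  then obtain T where T: "T \<subseteq> needed_rays A \<inter> quadrant s t" "card T = 3"
    using obtain_subset_with_card_n[of 3 "needed_rays A \<inter> quadrant s t"] by (metis not_less_eq_eq numeral_2_eq_2 numeral_3_eq_3)
  then obtain u v w where uvw: "T = {u, v, w}" "u \<noteq> v" "u \<noteq> w" "v \<noteq> w"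
    by (auto simp: card_3_iff)
  have Q: "u \<in> quadrant s t" "v \<in> quadrant s t" "w \<in> quadrant s t"
    and N: "u \<in> needed_rays A" "v \<in> needed_rays A" "w \<in> needed_rays A"
    using T uvw by auto
  have I: "irred u" "irred v" "irred w" using N A by (auto simp: needed_rays_def)
  \<comment> \<open>Stated for all triples, so that the six possible angular orders need no separate treatment.\<close>
  have no_middle: False if "e1 \<in> needed_rays A" "e2 \<in> needed_rays A" "e3 \<in> needed_rays A"
      "e1 \<in> quadrant s t" "e2 \<in> quadrant s t" "e3 \<in> quadrant s t"
      "cross e1 e2 > 0" "cross e2 e3 > 0" for e1 e2 e3
  proof -
    have ne: "e1 \<noteq> e2" "e3 \<noteq> e2" using that by (auto simp: cross_def)
    have "e1 \<noteq> e3" using that by (auto simp: cross_def algebra_simps)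
    moreover have "irred e1" "irred e3" using that A by (auto simp: needed_rays_def)
    ultimately have "cross e1 e3 \<noteq> 0"
      using cross_nonzero_in_quadrant that st by blast
    moreover have "cross e1 e3 \<ge> 0"
      using cross_trans_in_quadrant that st by blast
    ultimately have "cross e1 e3 > 0" by simp
    then have "rvec e2 \<in> Cone (A - {e2})"
      using that ne by (intro middle_ray_in_Cone[of e1 _ e3]) (simp_all add: needed_rays_def)
    then show False using that(2) Cone_Diff_eq unfolding needed_rays_def by blast
  qed
  have total: "cross a b > 0 \<or> cross b a > 0" if "a \<in> {u, v, w}" "b \<in> {u, v, w}" "a \<noteq> b" for a b
  proof -
    have "cross a b \<noteq> 0" using that Q I st by (intro cross_nonzero_in_quadrant[of a s t b]) auto
    moreover have "cross b a = - cross a b" by (simp add: cross_def)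
    ultimately show ?thesis by linarith
  qed
  have "cross u v > 0 \<or> cross v u > 0" "cross u w > 0 \<or> cross w u > 0" "cross v w > 0 \<or> cross w v > 0"
    using total uvw by blast+
  then show False using no_middle N Q by blast
qed

lemma card_needed_rays:
  assumes "\<forall>e\<in>A. irred e"
  shows "card (needed_rays A) \<le> 8"
proof -
  let ?I = "{1, -1 :: int} \<times> {1, -1 :: int}"
  have "\<exists>i\<in>?I. e \<in> quadrant (fst i) (snd i)" for e
    by (cases "fst e \<ge> 0"; cases "snd e \<ge> 0") (simp_all add: quadrant_def)
  then have "needed_rays A = (\<Union>i\<in>?I. needed_rays A \<inter> quadrant (fst i) (snd i))"
    by blast
  then have "card (needed_rays A) \<le> (\<Sum>i\<in>?I. card (needed_rays A \<inter> quadrant (fst i) (snd i)))"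
    using card_UN_le[of ?I "\<lambda>i. needed_rays A \<inter> quadrant (fst i) (snd i)"] by simp
  also have "\<dots> \<le> (\<Sum>i\<in>?I. 2)"
  proof (rule sum_mono)
    fix i assume "i \<in> ?I"
    then have "\<bar>fst i\<bar> = 1" "\<bar>snd i\<bar> = 1" by auto
    then show "card (needed_rays A \<inter> quadrant (fst i) (snd i)) \<le> 2"
      by (rule card_needed_rays_quadrant[OF assms])
  qed
  also have "\<dots> = 8" by simp
  finally show ?thesis .
qed

text \<open>Lattice vectors stay atomic from here on: splitting them into coordinates hides the instances of
  the stencil conditions from the automation.\<close>

declare split_paired_All [simp del] split_paired_Ex [simp del]

text \<open>What is left of a minimal family of stencils for the counting argument: every candidate that
  violates its inequality is present, and each \<open>e\<close> that is no parent within its stencil is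
  needed, either for visibility or because its own inequality is violated.\<close>

locale minimal_stencils = lattice_convex +
  fixes S :: "zvec \<Rightarrow> zvec set"
  assumes stencil: "\<And>z e. z \<in> Z \<Longrightarrow> e \<in> S z \<Longrightarrow> irred e \<and> z + e \<in> Z"
    and refined: "\<And>z e f g. z \<in> Z \<Longrightarrow> has_parents e f g \<Longrightarrow> f \<in> S z \<Longrightarrow> g \<in> S z \<Longrightarrow> z + e \<in> Z \<Longrightarrow>
      w (z + e) + w z < w (z + f) + w (z + g) \<Longrightarrow> e \<in> S z"
    and minimal: "\<And>z e. z \<in> Z \<Longrightarrow> e \<in> S z \<Longrightarrow> (\<And>e'. e' \<in> S z \<Longrightarrow> \<not> is_parent e e') \<Longrightarrow>
      Cone (S z - {e}) = Cone (S z) \<Longrightarrow>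
      \<exists>f g. has_parents e f g \<and> f \<in> S z \<and> g \<in> S z \<and> w (z + e) + w z < w (z + f) + w (z + g)"
begin

definition leaves :: "zvec \<Rightarrow> zvec set" where
  "leaves z = {e \<in> S z. \<forall>e'\<in>S z. \<not> is_parent e e'}"

text \<open>The leaves that are present because the diagonal \<open>z, z + e\<close> is lower than the other diagonal
  of its parallelogram.\<close>

definition diagonal_leaf :: "zvec \<Rightarrow> zvec \<Rightarrow> zvec \<Rightarrow> zvec \<Rightarrow> bool" where
  "diagonal_leaf z e f g \<longleftrightarrow> z \<in> Z \<and> e \<in> leaves z \<and> has_parents e f g \<and> f \<in> S z \<and> g \<in> S z \<and>
     w (z + e) + w z < w (z + f) + w (z + g)"

lemma finite_stencil: "z \<in> Z \<Longrightarrow> finite (S z)"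
proof -
  assume "z \<in> Z"
  then have "e \<in> (\<lambda>y. y - z) ` Z" if "e \<in> S z" for e
    using stencil[OF _ that] by (intro image_eqI[of _ _ "z + e"]) simp_all
  then have "S z \<subseteq> (\<lambda>y. y - z) ` Z" by blast
  then show ?thesis using fin finite_surj by blast
qed

lemma diagonal_leafD:
  assumes "diagonal_leaf z e f g"
  shows "z \<in> Z" "e \<in> S z" "f \<in> S z" "g \<in> S z" "irred e" "z + e \<in> Z" "z + f \<in> Z" "z + g \<in> Z"
    "has_parents e f g" "e = f + g" "w (z + e) + w z < w (z + f) + w (z + g)"
    "\<And>e'. e' \<in> S z \<Longrightarrow> \<not> is_parent e e'"
  using assms stencil unfolding diagonal_leaf_def leaves_def has_parents_iff by blast+

text \<open>Otherwise \<open>e + g\<close> or \<open>e + f\<close> would belong to the stencil by \<open>steeper_diagonal\<close>, according to the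
  side on which the segment leaves the diagonal. Both have \<open>e\<close> as a parent, and \<open>e\<close> is a leaf.\<close>

lemma crossing_not_below_diagonal_leaf:
  assumes leaf: "diagonal_leaf z e f g"
    and Z: "frame_point z f g A B \<in> Z" "frame_point z f g (1 - A) (1 - B) \<in> Z"
    and AB: "A \<ge> 1" "B \<ge> 1" "A \<noteq> B"
  shows "w z + w (z + e) \<le> w (frame_point z f g A B) + w (frame_point z f g (1 - A) (1 - B))"
proof (rule ccontr)
  assume n: "\<not> ?thesis"
  note p = diagonal_leafD[OF leaf]
  have less: "w (frame_point z f g A B) + w (frame_point z f g (1 - A) (1 - B)) < w z + w (z + (f + g))"
    using n p(10) by simp
  have fgZ: "z + (f + g) \<in> Z" using p by simp
  consider "A < B" | "B < A" using AB by linarith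
  then show False
  proof cases
    case 1
    note st = steeper_diagonal[OF p(1) p(8) fgZ Z AB(1) 1 less]
    have "e + g \<in> S z"
      by (rule refined[OF p(1) has_parents_add(1)[OF p(9)] p(2,4)]) (use st p(10) in \<open>simp_all\<close>)
    then show False using p(12) has_parents_add(1)[OF p(9)] unfolding is_parent_def by blast
  next
    case 2
    have swap: "g + f = f + g" "frame_point z g f B A = frame_point z f g A B"
      "frame_point z g f (1 - B) (1 - A) = frame_point z f g (1 - A) (1 - B)"
      by (simp_all add: add.commute frame_point_def)
    note st = steeper_diagonal[of z f g B A, unfolded swap, OF p(1) p(7) fgZ Z AB(2) 2 less]
    have "e + f \<in> S z"
      by (rule refined[OF p(1) has_parents_add(2)[OF p(9)] p(3,2)]) (use st p(10) in \<open>simp_all\<close>)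
    then show False using p(12) has_parents_add(2)[OF p(9)] unfolding is_parent_def by blast
  qed
qed

text \<open>A diagonal leaf is lowest among all segments with the same midpoint, and shortest among the
  lowest ones. In the frame \<open>(z, f, g)\<close> the competitor joins \<open>(A, B)\<close> and \<open>(1 - A, 1 - B)\<close>; the
  sign patterns are settled by \<open>crossing_diagonal\<close> and \<open>crossing_not_below_diagonal_leaf\<close>.\<close>

lemma diagonal_leaf_lowest:
  assumes leaf: "diagonal_leaf z e f g"
    and v: "z' \<in> Z" "z' + e' \<in> Z" "irred e'" "z' + (z' + e') = z + (z + e)"
    and le: "w z' + w (z' + e') \<le> w z + w (z + e)"
  shows "e' = e \<or> e' = - e \<or> w z' + w (z' + e') = w z + w (z + e) \<and> dot e' e' > dot e e"
proof -
  note p = diagonal_leafD[OF leaf]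
  have e: "cross f g = 1" "dot f g \<ge> 0" "e = f + g" using p(9) by (simp_all add: has_parents_iff)
  define A B where AB: "A = cross (z' + e' - z) g" "B = cross f (z' + e' - z)"
  have q: "z' + e' = frame_point z f g A B"
    using frame_point_cross[OF e(1), of z "z' + e' - z"] by (simp add: AB)
  have z': "z' = z + (z + e) - (z' + e')" unfolding eq_diff_eq by (rule v(4))
  have p': "z' = frame_point z f g (1 - A) (1 - B)"
  proof -
    have "z + (z + (f + g)) - frame_point z f g A B = frame_point z f g (1 - A) (1 - B)"
      by (simp add: frame_point_def prod_eq_iff algebra_simps)
    then show ?thesis using z' q e(3) by metis
  qed
  have e': "e' = frame_point 0 f g (2 * A - 1) (2 * B - 1)"
  proof -
    have "frame_point z f g A B - frame_point z f g (1 - A) (1 - B) = frame_point 0 f g (2 * A - 1) (2 * B - 1)"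
      by (simp add: frame_point_def prod_eq_iff algebra_simps)
    then show ?thesis using q p' by (metis add_diff_cancel_left')
  qed
  \<comment> \<open>Up to an exchange of its endpoints, the competitor lies in the cone of \<open>f\<close> and \<open>g\<close>.\<close>
  have upper: ?thesis if ab: "a \<ge> 1" "b \<ge> 1" and
    sgn: "e' = frame_point 0 f g (2 * a - 1) (2 * b - 1) \<or> e' = - frame_point 0 f g (2 * a - 1) (2 * b - 1)" and
    Z: "frame_point z f g a b \<in> Z" "frame_point z f g (1 - a) (1 - b) \<in> Z" and
    W: "w (frame_point z f g a b) + w (frame_point z f g (1 - a) (1 - b)) = w z' + w (z' + e')" for a b
  proof (cases "a = b")
    case True
    then have E: "frame_point 0 f g (2 * a - 1) (2 * b - 1) = ((2 * a - 1) * fst e, (2 * a - 1) * snd e)"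
      by (simp add: frame_point_def e algebra_simps)
    then have "2 * a - 1 dvd fst e'" "2 * a - 1 dvd snd e'" using sgn by auto
    then have "2 * a - 1 dvd 1" using v(3) unfolding irred_def by (metis gcd_greatest)
    then have "a = 1" using ab(1) by (simp add: zdvd1_eq)
    then show ?thesis using sgn E by auto
  next
    case False
    have "w z' + w (z' + e') = w z + w (z + e)"
      using crossing_not_below_diagonal_leaf[OF leaf Z ab False] W le by simp
    moreover have "dot e' e' = (2 * a - 1)\<^sup>2 * dot f f + 2 * ((2 * a - 1) * (2 * b - 1)) * dot f g + (2 * b - 1)\<^sup>2 * dot g g"
    proof -
      have "dot e' e' = dot (frame_point 0 f g (2 * a - 1) (2 * b - 1)) (frame_point 0 f g (2 * a - 1) (2 * b - 1))"
        using sgn by (elim disjE) (simp_all add: dot_def)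
      then show ?thesis unfolding frame_point_def dot_def fst_conv snd_conv fst_zero snd_zero
        by algebra
    qed
    moreover have "dot e e = dot f f + 2 * dot f g + dot g g"
      by (simp add: e dot_def algebra_simps)
    moreover have "dot f f + 2 * dot f g + dot g g < (2 * a - 1)\<^sup>2 * dot f f + 2 * ((2 * a - 1) * (2 * b - 1)) * dot f g + (2 * b - 1)\<^sup>2 * dot g g"
    proof -
      have d: "dot f f \<ge> 1" "dot g g \<ge> 1" using dot_self_pos e by auto
      have 1: "1 \<le> (2 * t - 1)\<^sup>2" "t \<noteq> 1 \<Longrightarrow> 2 \<le> (2 * t - 1)\<^sup>2" if "t \<ge> 1" for t :: int
      proof -
        have "(2 * t - 1)\<^sup>2 = 1 + 4 * (t * (t - 1))" by (simp add: power2_eq_square algebra_simps)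
        moreover have "t * (t - 1) \<ge> 0" using that by (intro mult_nonneg_nonneg) auto
        moreover have "t * (t - 1) > 0" if "t \<noteq> 1" using that \<open>t \<ge> 1\<close> by (intro mult_pos_pos) auto
        ultimately show "1 \<le> (2 * t - 1)\<^sup>2" "t \<noteq> 1 \<Longrightarrow> 2 \<le> (2 * t - 1)\<^sup>2" by force+
      qed
      have "1 * dot f g \<le> ((2 * a - 1) * (2 * b - 1)) * dot f g"
      proof (rule mult_right_mono)
        have "0 < (2 * a - 1) * (2 * b - 1)" using ab by (intro mult_pos_pos) simp_all
        then show "1 \<le> (2 * a - 1) * (2 * b - 1)" by simp
      qed (rule e(2))
      moreover have "1 * dot f f \<le> (2 * a - 1)\<^sup>2 * dot f f" "1 * dot g g \<le> (2 * b - 1)\<^sup>2 * dot g g"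
        using d 1 ab
        by (intro mult_right_mono; simp)+
      moreover have "2 * dot f f \<le> (2 * a - 1)\<^sup>2 * dot f f \<or> 2 * dot g g \<le> (2 * b - 1)\<^sup>2 * dot g g"
      proof (cases "a = 1")
        case True
        then have "2 \<le> (2 * b - 1)\<^sup>2" using 1 ab False by blast
        then have "2 * dot g g \<le> (2 * b - 1)\<^sup>2 * dot g g" using d by (intro mult_right_mono) simp_all
        then show ?thesis ..
      next
        case False
        then have "2 \<le> (2 * a - 1)\<^sup>2" using 1 ab by blast
        then have "2 * dot f f \<le> (2 * a - 1)\<^sup>2 * dot f f" using d by (intro mult_right_mono) simp_all
        then show ?thesis ..
      qed
      ultimately show ?thesis using d by linarith
    qed
    ultimately show ?thesis by simp
  qed
  have ZZ: "frame_point z f g A B \<in> Z" "frame_point z f g (1 - A) (1 - B) \<in> Z"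
    using v q p' by auto
  have W: "w (frame_point z f g A B) + w (frame_point z f g (1 - A) (1 - B)) = w z' + w (z' + e')"
    using q p' by simp
  have fgZ: "z + (f + g) \<in> Z" using p by simp
  have le': "w (frame_point z f g A B) + w (frame_point z f g (1 - A) (1 - B)) \<le> w z + w (z + (f + g))"
    using W le p(10) by simp
  consider "A \<ge> 1" "B \<ge> 1" | "A \<le> 0" "B \<le> 0" | "A \<ge> 1" "B \<le> 0" | "A \<le> 0" "B \<ge> 1" by linarith
  then show ?thesis
  proof cases
    case 1
    then show ?thesis using upper[of A B] e' ZZ W by auto
  next
    case 2
    have "frame_point 0 f g (2 * (1 - A) - 1) (2 * (1 - B) - 1) = - e'"
      unfolding e' by (simp add: frame_point_def algebra_simps)
    then show ?thesis using upper[of "1 - A" "1 - B"] 2 ZZ W by auto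
  next
    case 3
    then show ?thesis using crossing_diagonal[OF p(1) fgZ ZZ 3 le'] p(10,11) by simp
  next
    case 4
    have swap: "g + f = f + g" "frame_point z g f B A = frame_point z f g A B"
      "frame_point z g f (1 - B) (1 - A) = frame_point z f g (1 - A) (1 - B)"
      by (simp_all add: add.commute frame_point_def)
    show ?thesis
      using crossing_diagonal[of z g f B A, unfolded swap, OF p(1) fgZ ZZ 4(2,1) le'] p(10,11) by simp
  qed
qed

text \<open>Two diagonal leaves with the same midpoint are both lowest and would each be strictly shorter
  than the other, so they are the same segment.\<close>

lemma diagonal_leaf_midpoint:
  assumes l: "diagonal_leaf z e f g" "diagonal_leaf z' e' f' g'"
    and m: "z' + (z' + e') = z + (z + e)"
  shows "e' = e \<or> e' = - e"
proof -
  have "z \<in> Z \<and> z + e \<in> Z \<and> irred e" if "diagonal_leaf z e f g" for z e f g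
    using that stencil unfolding diagonal_leaf_def leaves_def by blast
  then have Z: "z \<in> Z" "z + e \<in> Z" "irred e" "z' \<in> Z" "z' + e' \<in> Z" "irred e'"
    using l by blast+
  show ?thesis
  proof (rule ccontr)
    assume ne: "\<not> ?thesis"
    then have ne': "\<not> (e = e' \<or> e = - e')" by auto
    have 1: "w z' + w (z' + e') = w z + w (z + e) \<and> dot e' e' > dot e e"
      if "w z' + w (z' + e') \<le> w z + w (z + e)"
      using diagonal_leaf_lowest[OF l(1) Z(4-6) m that] ne by blast
    have 2: "w z + w (z + e) = w z' + w (z' + e') \<and> dot e e > dot e' e'"
      if "w z + w (z + e) \<le> w z' + w (z' + e')"
      using diagonal_leaf_lowest[OF l(2) Z(1-3) m[symmetric] that] ne' by blast
    have eq: "w z' + w (z' + e') = w z + w (z + e)"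
      using 1 2 by (cases "w z' + w (z' + e') \<le> w z + w (z + e)") auto
    show False using 1[OF eq_refl[OF eq]] 2[OF eq_refl[OF eq[symmetric]]] by simp
  qed
qed

definition diagonal_leaf_pairs :: "(zvec \<times> zvec) set" where
  "diagonal_leaf_pairs = {(z, e). \<exists>f g. diagonal_leaf z e f g}"

text \<open>A midpoint and the bit \<open>pos\<close>, which distinguishes the two orientations of a segment, determine
  a diagonal leaf. The midpoint belongs to an edge of the unimodular triangle \<open>z, z + f, z + e\<close>.\<close>

lemma card_diagonal_leaf_pairs: "finite diagonal_leaf_pairs \<and> card diagonal_leaf_pairs \<le> 12 * card Z"
proof -
  define pos where "pos e \<longleftrightarrow> fst e > 0 \<or> fst e = 0 \<and> snd e > 0" for e :: zvec
  let ?F = "\<lambda>(z, e). (z + (z + e), pos e)"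
  have "inj_on ?F diagonal_leaf_pairs"
  proof (rule inj_onI)
    fix t t' assume "t \<in> diagonal_leaf_pairs" "t' \<in> diagonal_leaf_pairs" and eq: "?F t = ?F t'"
    then obtain z e f g z' e' f' g' where t: "t = (z, e)" "t' = (z', e')"
      and l: "diagonal_leaf z e f g" "diagonal_leaf z' e' f' g'"
      unfolding diagonal_leaf_pairs_def by blast
    have m: "z' + (z' + e') = z + (z + e)" and s: "pos e = pos e'" using eq t by simp_all
    have "irred e" using l(1) stencil unfolding diagonal_leaf_def leaves_def by blast
    then have "fst e \<noteq> 0 \<or> snd e \<noteq> 0" by (auto simp: irred_def)
    then have e: "e' = e" using diagonal_leaf_midpoint[OF l m] s by (auto simp: pos_def)
    then have "fst z' = fst z" "snd z' = snd z" using m by (simp_all add: prod_eq_iff)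
    then show "t = t'" using e t by (simp add: prod_eq_iff)
  qed
  moreover have "?F ` diagonal_leaf_pairs \<subseteq> triangle_edge_sums \<times> UNIV"
  proof -
    have "z + (z + e) \<in> triangle_edge_sums" if l: "diagonal_leaf z e f g" for z e f g
    proof -
      have p: "z \<in> Z" "z + f \<in> Z" "z + e \<in> Z" "has_parents e f g"
        using l stencil unfolding diagonal_leaf_def leaves_def by blast+
      then have "cross f g = 1" "e = f + g" by (simp_all add: has_parents_iff)
      moreover have "cross (z - (z + f)) (z + (f + g) - (z + f)) = - cross f g"
        by (simp add: cross_def)
      ultimately have "\<bar>cross (z - (z + f)) (z + e - (z + f))\<bar> = 1" by simp
      then show ?thesis using p unfolding triangle_edge_sums_def by blast
    qed
    then show ?thesis by (auto simp: diagonal_leaf_pairs_def)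
  qed
  moreover have "finite (triangle_edge_sums \<times> (UNIV :: bool set))"
    "card (triangle_edge_sums \<times> (UNIV :: bool set)) \<le> 12 * card Z"
    using card_triangle_edge_sums by (auto simp: card_cartesian_product)
  ultimately show ?thesis
    by (meson card_inj_on_le inj_on_finite le_trans)
qed

text \<open>Per point at most 8 leaves are needed for visibility, and in total at most \<open>12 N\<close> leaves are
  diagonal.\<close>

lemma sum_card_leaves: "(\<Sum>z\<in>Z. card (leaves z)) \<le> 20 * card Z"
proof -
  define D where "D z = {e. (z, e) \<in> diagonal_leaf_pairs}" for z
  have finD: "finite (D z)" for z
    using card_diagonal_leaf_pairs finite_subset[of "Pair z ` D z" diagonal_leaf_pairs]
    by (auto simp: D_def finite_image_iff inj_on_def)
  have "card (leaves z) \<le> 8 + card (D z)" if "z \<in> Z" for z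
  proof -
    have "leaves z \<subseteq> needed_rays (S z) \<union> D z"
      using minimal[OF that] that unfolding leaves_def needed_rays_def D_def diagonal_leaf_pairs_def diagonal_leaf_def
      by blast
    moreover have "finite (needed_rays (S z) \<union> D z)"
      using finD finite_stencil[OF that] by (auto simp: needed_rays_def)
    ultimately have "card (leaves z) \<le> card (needed_rays (S z) \<union> D z)" by (rule card_mono[rotated])
    also have "\<dots> \<le> card (needed_rays (S z)) + card (D z)" by (rule card_Un_le)
    finally show ?thesis using card_needed_rays[of "S z"] stencil[OF that] by force
  qed
  then have "(\<Sum>z\<in>Z. card (leaves z)) \<le> (\<Sum>z\<in>Z. 8 + card (D z))" by (rule sum_mono)
  also have "\<dots> = 8 * card Z + (\<Sum>z\<in>Z. card (D z))" by (simp add: sum.distrib)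
  also have "(\<Sum>z\<in>Z. card (D z)) = card (Sigma Z D)" using fin finD by (simp add: card_SigmaI)
  also have "\<dots> \<le> card diagonal_leaf_pairs"
    using card_diagonal_leaf_pairs by (intro card_mono) (auto simp: D_def)
  also have "8 * card Z + card diagonal_leaf_pairs \<le> 20 * card Z" using card_diagonal_leaf_pairs by simp
  finally show ?thesis by simp
qed

text \<open>Going from children to children, each element of a stencil leads to a leaf, of which it is an
  ancestor.\<close>

lemma card_stencil_le:
  assumes z: "z \<in> Z" and R: "\<And>e. e \<in> S z \<Longrightarrow> real (l1 e + 1) \<le> R"
  shows "real (card (S z)) \<le> R * real (card (leaves z))"
proof -
  obtain A where A: "\<And>e. finite (A e)" "\<And>e. e \<in> A e"
    "\<And>e a f. a \<in> A e \<Longrightarrow> is_parent f a \<Longrightarrow> f \<in> A e" "\<And>e. card (A e) \<le> l1 e + 1"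
    using few_ancestors by metis
  define M where "M = Max (l1 ` S z)"
  have below: "e \<in> (\<Union>l\<in>leaves z. A l)" if "e \<in> S z" for e
    using that
  proof (induction "M - l1 e" arbitrary: e rule: less_induct)
    case less
    show ?case
    proof (cases "e \<in> leaves z")
      case False
      then obtain e' where e': "e' \<in> S z" "is_parent e e'" using less.prems by (auto simp: leaves_def)
      then obtain g where "has_parents e' e g \<or> has_parents e' g e" unfolding is_parent_def by blast
      then have "l1 e < l1 e'" using l1_parents[of e' e g] l1_parents[of e' g e] by linarith
      moreover have "l1 e' \<le> M" unfolding M_def using e' finite_stencil[OF z] by auto
      ultimately have "e' \<in> (\<Union>l\<in>leaves z. A l)" using e'(1) by (intro less.hyps) simp_all
      then show ?thesis using A(3) e'(2) by blast
    qed (use A(2) in blast)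
  qed
  have fl: "finite (leaves z)" using finite_stencil[OF z] by (simp add: leaves_def)
  have "card (S z) \<le> card (\<Union>l\<in>leaves z. A l)"
    using below fl A by (intro card_mono) auto
  also have "\<dots> \<le> (\<Sum>l\<in>leaves z. card (A l))" using fl by (rule card_UN_le)
  also have "\<dots> \<le> (\<Sum>l\<in>leaves z. l1 l + 1)" using A by (intro sum_mono)
  finally have "real (card (S z)) \<le> (\<Sum>l\<in>leaves z. real (l1 l + 1))"
    by (metis of_nat_le_iff of_nat_sum)
  also have "\<dots> \<le> (\<Sum>l\<in>leaves z. R)" using R by (intro sum_mono) (auto simp: leaves_def)
  finally show ?thesis by (simp add: mult.commute)
qed

lemma total_card_le:
  assumes R: "\<And>z e. z \<in> Z \<Longrightarrow> e \<in> S z \<Longrightarrow> real (l1 e + 1) \<le> R" and R0: "R \<ge> 0"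
  shows "real (\<Sum>z\<in>Z. card (S z)) \<le> 20 * R * real (card Z)"
proof -
  have "real (\<Sum>z\<in>Z. card (S z)) \<le> (\<Sum>z\<in>Z. R * real (card (leaves z)))"
    using card_stencil_le R by (auto intro!: sum_mono)
  also have "\<dots> = R * real (\<Sum>z\<in>Z. card (leaves z))" by (simp add: sum_distrib_left)
  also have "\<dots> \<le> R * real (20 * card Z)" using sum_card_leaves R0
    by (intro mult_left_mono) (simp_all only: of_nat_le_iff)
  finally show ?thesis by simp
qed

end

section \<open>From the rotated grid to the integer lattice\<close>

definition node :: "real \<Rightarrow> real \<Rightarrow> plane \<Rightarrow> zvec \<Rightarrow> plane" where
  "node h \<theta> \<xi> z = h *\<^sub>R rot \<theta> (\<xi> + rvec z)"

lemma rvec_add: "rvec (z + z') = rvec z + rvec z'"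
  by (simp add: rvec_def)

lemma rot_add: "rot \<theta> (p + q) = rot \<theta> p + rot \<theta> q"
  and rot_scaleR: "rot \<theta> (c *\<^sub>R p) = c *\<^sub>R rot \<theta> p"
  by (simp_all add: rot_def algebra_simps)

lemma norm_rot: "norm (rot \<theta> p) = norm p"
proof -
  obtain x y where p: "p = (x, y)" by (cases p)
  have "(cos \<theta> * x - sin \<theta> * y)\<^sup>2 + (sin \<theta> * x + cos \<theta> * y)\<^sup>2 = x\<^sup>2 + y\<^sup>2"
    using sin_cos_squared_add[of \<theta>] by algebra
  then show ?thesis by (simp add: p rot_def norm_Pair)
qed

lemma shift_node: "shift h \<theta> (node h \<theta> \<xi> z) e = node h \<theta> \<xi> (z + e)"
  by (simp add: shift_def node_def rvec_add rot_add scaleR_add_right add.assoc)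

lemma dist_node: "h > 0 \<Longrightarrow> dist (node h \<theta> \<xi> z) (node h \<theta> \<xi> (z + e)) = h * norm (rvec e)"
  unfolding shift_node[symmetric] by (simp add: shift_def dist_norm norm_rot)

lemma rvec_coords_le_norm: "\<bar>real_of_int (fst e)\<bar> \<le> norm (rvec e)" "\<bar>real_of_int (snd e)\<bar> \<le> norm (rvec e)"
  using norm_fst_le[of "fst (rvec e)" "snd (rvec e)"] norm_snd_le[of "snd (rvec e)" "fst (rvec e)"]
  by (simp_all add: rvec_def)

lemma inj_node: assumes "h > 0" shows "inj (node h \<theta> \<xi>)"
proof (rule injI)
  fix z z' assume "node h \<theta> \<xi> z = node h \<theta> \<xi> z'"
  then have "h * norm (rvec (z' - z)) = 0" using dist_node[OF assms, of \<theta> \<xi> z "z' - z"] by simp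
  then have "norm (rvec (z' - z)) = 0" using assms by simp
  then have "fst (z' - z) = 0" "snd (z' - z) = 0" using rvec_coords_le_norm[of "z' - z"] by simp_all
  then show "z = z'" by (simp add: prod_eq_iff)
qed

lemma step_le_diameter:
  assumes "compact \<Omega>" "h > 0" "node h \<theta> \<xi> z \<in> \<Omega>" "node h \<theta> \<xi> (z + e) \<in> \<Omega>"
  shows "norm (rvec e) \<le> diameter \<Omega> / h"
proof -
  have "dist (node h \<theta> \<xi> z) (node h \<theta> \<xi> (z + e)) \<le> diameter \<Omega>"
    using assms by (intro diameter_bounded_bound) (auto intro: compact_imp_bounded)
  then show ?thesis using assms(2) by (simp add: dist_node[OF assms(2)] pos_le_divide_eq mult.commute)
qed

lemma finite_nodes:
  assumes "compact \<Omega>" "h > 0"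
  shows "finite {z. node h \<theta> \<xi> z \<in> \<Omega>}"
proof (cases "{z. node h \<theta> \<xi> z \<in> \<Omega>} = {}")
  case False
  then obtain z0 where z0: "node h \<theta> \<xi> z0 \<in> \<Omega>" by blast
  define M where "M = \<lceil>diameter \<Omega> / h\<rceil>"
  have "z \<in> (\<lambda>v. z0 + v) ` ({-M..M} \<times> {-M..M})" if "node h \<theta> \<xi> z \<in> \<Omega>" for z
  proof
    show "z = z0 + (z - z0)" by simp
    have "norm (rvec (z - z0)) \<le> diameter \<Omega> / h"
      using that by (intro step_le_diameter[OF assms z0]) simp
    then have "\<bar>real_of_int (fst (z - z0))\<bar> \<le> M" "\<bar>real_of_int (snd (z - z0))\<bar> \<le> M"
      using rvec_coords_le_norm[of "z - z0"] unfolding M_def by linarith+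
    then have "\<bar>fst (z - z0)\<bar> \<le> M" "\<bar>snd (z - z0)\<bar> \<le> M" by linarith+
    then show "z - z0 \<in> {-M..M} \<times> {-M..M}" by (simp add: mem_Times_iff abs_le_iff)
  qed
  then have "{z. node h \<theta> \<xi> z \<in> \<Omega>} \<subseteq> (\<lambda>v. z0 + v) ` ({-M..M} \<times> {-M..M})" by blast
  then show ?thesis by (rule finite_subset) simp
qed simp

lemma convex_on_three:
  fixes U :: "'a::real_vector \<Rightarrow> real"
  assumes "convex_on C U" "p \<in> C" "q \<in> C" "r \<in> C" "a \<ge> 0" "b \<ge> 0" "c \<ge> 0" "a + b + c = 1"
  shows "a *\<^sub>R p + b *\<^sub>R q + c *\<^sub>R r \<in> C"
    and "U (a *\<^sub>R p + b *\<^sub>R q + c *\<^sub>R r) \<le> a * U p + b * U q + c * U r"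
proof -
  let ?k = "\<lambda>i::nat. if i = 0 then a else if i = 1 then b else c"
  let ?y = "\<lambda>i::nat. if i = 0 then p else if i = 1 then q else r"
  have C: "convex C" using assms(1) by (rule convex_on_imp_convex)
  have "(\<Sum>i\<in>{0,1,2}. ?k i *\<^sub>R ?y i) \<in> C"
    using C assms by (intro convex_sum) auto
  then show "a *\<^sub>R p + b *\<^sub>R q + c *\<^sub>R r \<in> C" by (simp add: add.assoc)
  have "U (\<Sum>i\<in>{0,1,2}. ?k i *\<^sub>R ?y i) \<le> (\<Sum>i\<in>{0,1,2}. ?k i * U (?y i))"
    using assms by (intro convex_on_sum) auto
  then show "U (a *\<^sub>R p + b *\<^sub>R q + c *\<^sub>R r) \<le> a * U p + b * U q + c * U r" by (simp add: add.assoc)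
qed

lemma node_weighted:
  fixes s a b c :: int
  assumes "s > 0" "s = a + b + c"
    and "s * fst z = a * fst z1 + b * fst z2 + c * fst z3"
    and "s * snd z = a * snd z1 + b * snd z2 + c * snd z3"
  shows "node h \<theta> \<xi> z = (a / s) *\<^sub>R node h \<theta> \<xi> z1 + (b / s) *\<^sub>R node h \<theta> \<xi> z2 + (c / s) *\<^sub>R node h \<theta> \<xi> z3"
proof -
  have 1: "real_of_int a / s + b / s + c / s = 1"
  proof -
    have "real_of_int a + b + c = s" by (simp add: assms(2))
    then show ?thesis using assms(1) by (simp add: add_divide_distrib[symmetric])
  qed
  have "real_of_int s * fst z = a * fst z1 + b * fst z2 + c * fst z3"
    "real_of_int s * snd z = a * snd z1 + b * snd z2 + c * snd z3"
    using assms(3,4) by (metis of_int_add of_int_mult)+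
  then have r: "rvec z = (a / s) *\<^sub>R rvec z1 + (b / s) *\<^sub>R rvec z2 + (c / s) *\<^sub>R rvec z3"
    using assms(1) by (simp add: rvec_def field_simps)
  have "\<xi> = (a / s + b / s + c / s) *\<^sub>R \<xi>" using 1 by simp
  then have "\<xi> + rvec z = (a / s) *\<^sub>R (\<xi> + rvec z1) + (b / s) *\<^sub>R (\<xi> + rvec z2) + (c / s) *\<^sub>R (\<xi> + rvec z3)"
    unfolding r by (simp only: scaleR_add_left scaleR_add_right) (simp add: add_ac)
  then show ?thesis by (simp add: node_def rot_add rot_scaleR scaleR_add_right mult.commute)
qed

lemma lattice_convex_nodes:
  assumes "compact \<Omega>" "h > 0" "convex_on \<Omega> U" "\<And>z. node h \<theta> \<xi> z \<in> \<Omega> \<Longrightarrow> w z = U (node h \<theta> \<xi> z)"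
  shows "lattice_convex {z. node h \<theta> \<xi> z \<in> \<Omega>} w"
proof
  show "finite {z. node h \<theta> \<xi> z \<in> \<Omega>}" using assms by (intro finite_nodes)
next
  fix z z1 z2 z3 and a b c :: int
  assume Z: "z1 \<in> {z. node h \<theta> \<xi> z \<in> \<Omega>}" "z2 \<in> {z. node h \<theta> \<xi> z \<in> \<Omega>}" "z3 \<in> {z. node h \<theta> \<xi> z \<in> \<Omega>}"
    and abc: "0 \<le> a" "0 \<le> b" "0 \<le> c" "0 < a + b + c"
    and eq: "(a + b + c) * fst z = a * fst z1 + b * fst z2 + c * fst z3"
      "(a + b + c) * snd z = a * snd z1 + b * snd z2 + c * snd z3"
  define s where "s = a + b + c"
  have s: "s > 0" using abc s_def by simp
  have sum: "real_of_int a / s + b / s + c / s = 1"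
  proof -
    have "real_of_int a + b + c = s" by (simp add: s_def)
    then show ?thesis using s by (simp add: add_divide_distrib[symmetric])
  qed
  have N: "node h \<theta> \<xi> z = (a / s) *\<^sub>R node h \<theta> \<xi> z1 + (b / s) *\<^sub>R node h \<theta> \<xi> z2 + (c / s) *\<^sub>R node h \<theta> \<xi> z3"
    using node_weighted[OF s s_def] eq by (simp add: s_def)
  have C: "node h \<theta> \<xi> z \<in> \<Omega>"
    "U (node h \<theta> \<xi> z) \<le> (a / s) * U (node h \<theta> \<xi> z1) + (b / s) * U (node h \<theta> \<xi> z2) + (c / s) * U (node h \<theta> \<xi> z3)"
    unfolding N using Z abc s sum by (intro convex_on_three[OF assms(3)]; simp)+
  have "s * U (node h \<theta> \<xi> z) \<le> a * U (node h \<theta> \<xi> z1) + b * U (node h \<theta> \<xi> z2) + c * U (node h \<theta> \<xi> z3)"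
    using C(2) s by (simp add: field_simps)
  then show "z \<in> {z. node h \<theta> \<xi> z \<in> \<Omega>} \<and>
      real_of_int (a + b + c) * w z \<le> real_of_int a * w z1 + real_of_int b * w z2 + real_of_int c * w z3"
    using C(1) Z assms(4) unfolding s_def by simp
qed

text \<open>Remove \<open>e\<close> from the stencil at \<open>x\<close>. Stability survives since \<open>e\<close> is a leaf, and visibility by
  assumption. The forms \<open>S\<close> and \<open>T\<close> give fewer conditions than before, and the only possible new
  candidate is \<open>e\<close> itself. By minimality its condition fails.\<close>

lemma leaf_below_other_diagonal:
  assumes sm: "smallest_stencil_family h \<theta> X u V" and x: "x \<in> X" and e: "e \<in> V x"
    and leaf: "\<And>e'. e' \<in> V x \<Longrightarrow> \<not> is_parent e e'"
    and cone: "Cone (V x - {e}) = Cone (V x)"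
  shows "\<exists>f g. has_parents e f g \<and> f \<in> V x \<and> g \<in> V x \<and> P_form h \<theta> x e f g u < 0"
proof (rule ccontr)
  assume no: "\<not> ?thesis"
  define W where "W = V(x := V x - {e})"
  have Wx: "W x = V x - {e}" and Wy: "\<And>y. y \<noteq> x \<Longrightarrow> W y = V y" by (auto simp: W_def)
  have fam: "stencil_family h \<theta> X V" and u: "u \<in> Conv_stencil h \<theta> X V"
    and least: "\<And>W. stencil_family h \<theta> X W \<Longrightarrow> u \<in> Conv_stencil h \<theta> X W \<Longrightarrow> \<forall>x\<in>X. V x \<subseteq> W x"
    using sm unfolding smallest_stencil_family_def by blast+
  have "stencil_family h \<theta> X W"
    unfolding stencil_family_def
  proof
    fix y assume y: "y \<in> X"
    have V: "V y \<subseteq> Vmax h \<theta> X y" "\<forall>e\<in>V y. \<forall>f\<in>Vmax h \<theta> X y. is_parent f e \<longrightarrow> f \<in> V y"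
      "Cone (V y) = Cone (Vmax h \<theta> X y)"
      using fam y unfolding stencil_family_def by blast+
    show "W y \<subseteq> Vmax h \<theta> X y \<and> (\<forall>e\<in>W y. \<forall>f\<in>Vmax h \<theta> X y. is_parent f e \<longrightarrow> f \<in> W y) \<and>
        Cone (W y) = Cone (Vmax h \<theta> X y)"
    proof (cases "y = x")
      case True
      have "\<forall>e'\<in>W x. \<forall>f\<in>Vmax h \<theta> X x. is_parent f e' \<longrightarrow> f \<in> W x"
        unfolding Wx using V(2) leaf True by blast
      moreover have "W x \<subseteq> Vmax h \<theta> X x" unfolding Wx using V(1) True by blast
      moreover have "Cone (W x) = Cone (Vmax h \<theta> X x)" unfolding Wx using V(3) cone True by simp
      ultimately show ?thesis using True by simp
    next
      case False
      then show ?thesis using V Wy by simp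
    qed
  qed
  moreover have "u \<in> Conv_stencil h \<theta> X W"
    unfolding Conv_stencil_def mem_Collect_eq
  proof (intro ballI conjI)
    fix y assume y: "y \<in> X"
    have sub: "W y \<subseteq> V y" using Wx Wy by (cases "y = x") auto
    have V: "\<And>e. e \<in> V y \<Longrightarrow> S_supp h \<theta> y e \<subseteq> X \<Longrightarrow> S_form h \<theta> y e u \<ge> 0"
      "\<And>e f g. e \<in> V y \<Longrightarrow> has_parents e f g \<Longrightarrow> T_supp h \<theta> y e f g \<subseteq> X \<Longrightarrow> T_form h \<theta> y e f g u \<ge> 0"
      "\<And>e f g. e \<in> candidates h \<theta> X V y \<Longrightarrow> has_parents e f g \<Longrightarrow> P_form h \<theta> y e f g u \<ge> 0"
      using u y unfolding Conv_stencil_def by blast+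
    show "S_supp h \<theta> y e' \<subseteq> X \<longrightarrow> S_form h \<theta> y e' u \<ge> 0" if "e' \<in> W y" for e'
      using V(1) that sub by blast
    show "\<forall>f g. has_parents e' f g \<longrightarrow> T_supp h \<theta> y e' f g \<subseteq> X \<longrightarrow> T_form h \<theta> y e' f g u \<ge> 0" if "e' \<in> W y" for e'
      using V(2) that sub by blast
    show "\<forall>f g. has_parents e' f g \<longrightarrow> P_form h \<theta> y e' f g u \<ge> 0" if e': "e' \<in> candidates h \<theta> X W y" for e'
    proof (intro allI impI)
      fix f g assume p: "has_parents e' f g"
      have c: "e' \<in> Vmax h \<theta> X y" "e' \<notin> W y" "f \<in> W y" "g \<in> W y"
        using e' parents_unique[OF p] unfolding candidates_def by blast+
      show "P_form h \<theta> y e' f g u \<ge> 0"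
      proof (cases "y = x \<and> e' = e")
        case True
        then show ?thesis using no p c sub by (meson not_less subsetD)
      next
        case False
        then have "e' \<notin> V y" using c(2) Wx Wy by (cases "y = x") auto
        then have "e' \<in> candidates h \<theta> X V y" using c sub p unfolding candidates_def by blast
        then show ?thesis using V(3) p by blast
      qed
    qed
  qed
  ultimately have "V x \<subseteq> W x" using least x by blast
  then show False using e Wx by blast
qed

text \<open>The constant is \<open>60 = 20 \<cdot> 3\<close>: there are at most \<open>20 N\<close> leaves, and a leaf \<open>e\<close> has at most
  \<open>\<parallel>e\<parallel>\<^sub>1 + 1 \<le> 3 \<parallel>e\<parallel> \<le> 3 diam(\<Omega>) / h\<close> ancestors, itself included.\<close>

lemma stencil_size_le:
  assumes \<Omega>: "compact \<Omega>" and h: "h > 0" and X: "X = \<Omega> \<inter> grid h \<theta> \<xi>"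
    and u: "u \<in> Conv_restr \<Omega> X" and sm: "smallest_stencil_family h \<theta> X u V"
  shows "real (stencil_size X V) \<le> 60 * real (card X) * (diameter \<Omega> / h)"
proof -
  define G where "G = node h \<theta> \<xi>"
  define Z where "Z = {z. G z \<in> \<Omega>}"
  define w where "w = (\<lambda>z. u (G z))"
  have XZ: "X = G ` Z" unfolding X grid_def Z_def G_def node_def by blast
  have GX: "G z \<in> X \<longleftrightarrow> z \<in> Z" for z
    using XZ inj_node[OF h, of \<theta> \<xi>] by (simp add: G_def inj_image_mem_iff)
  have shift: "shift h \<theta> (G z) e = G (z + e)" for z e by (simp add: G_def shift_node)
  have P: "P_form h \<theta> (G z) e f g u = w (z + e) - w (z + f) - w (z + g) + w z" for z e f g
    by (simp add: P_form_def shift w_def)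
  obtain U where U: "convex_on \<Omega> U" "\<forall>x\<in>X. u x = U x" using u unfolding Conv_restr_def by blast
  have fam: "stencil_family h \<theta> X V" and uV: "u \<in> Conv_stencil h \<theta> X V"
    using sm unfolding smallest_stencil_family_def by blast+
  interpret lattice_convex Z w
    unfolding Z_def G_def
  proof (rule lattice_convex_nodes[OF \<Omega> h U(1)])
    show "w z = U (node h \<theta> \<xi> z)" if "node h \<theta> \<xi> z \<in> \<Omega>" for z
      using that U(2) GX[of z] by (simp add: w_def Z_def G_def)
  qed
  interpret minimal_stencils Z w "\<lambda>z. V (G z)"
  proof
    fix z e assume z: "z \<in> Z" and e: "e \<in> V (G z)"
    have "e \<in> Vmax h \<theta> X (G z)" using fam GX z e unfolding stencil_family_def by blast
    then show "irred e \<and> z + e \<in> Z" by (simp add: Vmax_def shift GX)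
  next
    fix z e f g
    assume z: "z \<in> Z" and p: "has_parents e f g" and fg: "f \<in> V (G z)" "g \<in> V (G z)"
      and e: "z + e \<in> Z" and less: "w (z + e) + w z < w (z + f) + w (z + g)"
    show "e \<in> V (G z)"
    proof (rule ccontr)
      assume "e \<notin> V (G z)"
      moreover have "e \<in> Vmax h \<theta> X (G z)"
        using p e unfolding Vmax_def mem_Collect_eq shift GX has_parents_def by blast
      ultimately have "e \<in> candidates h \<theta> X V (G z)" using p fg unfolding candidates_def by blast
      then have "P_form h \<theta> (G z) e f g u \<ge> 0" using uV p GX z unfolding Conv_stencil_def by blast
      then show False using less by (simp add: P)
    qed
  next
    fix z e
    assume z: "z \<in> Z" and e: "e \<in> V (G z)" "\<And>e'. e' \<in> V (G z) \<Longrightarrow> \<not> is_parent e e'"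
      "Cone (V (G z) - {e}) = Cone (V (G z))"
    then obtain f g where fg: "has_parents e f g" "f \<in> V (G z)" "g \<in> V (G z)" "P_form h \<theta> (G z) e f g u < 0"
      using leaf_below_other_diagonal[OF sm] GX by blast
    then have "w (z + e) + w z < w (z + f) + w (z + g)" by (simp add: P)
    then show "\<exists>f g. has_parents e f g \<and> f \<in> V (G z) \<and> g \<in> V (G z) \<and>
        w (z + e) + w z < w (z + f) + w (z + g)" using fg by blast
  qed
  have injG: "inj_on G Z" using inj_node[OF h] unfolding G_def by (rule inj_on_subset) simp
  have "stencil_size X V = (\<Sum>z\<in>Z. card (V (G z)))"
    unfolding stencil_size_def XZ by (simp add: sum.reindex[OF injG])
  moreover have "card X = card Z" unfolding XZ using injG by (rule card_image)
  moreover have "real (l1 e + 1) \<le> 3 * (diameter \<Omega> / h)" if "z \<in> Z" "e \<in> V (G z)" for z e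
  proof -
    have e: "irred e" "z + e \<in> Z" using stencil that by blast+
    have n: "norm (rvec e) \<le> diameter \<Omega> / h"
      using that(1) e(2) unfolding Z_def G_def by (intro step_le_diameter[OF \<Omega> h]) auto
    have "fst e \<noteq> 0 \<or> snd e \<noteq> 0" using e(1) by (auto simp: irred_def)
    then have "1 \<le> \<bar>real_of_int (fst e)\<bar> \<or> 1 \<le> \<bar>real_of_int (snd e)\<bar>" by linarith
    then have "1 \<le> norm (rvec e)" using rvec_coords_le_norm[of e] by linarith
    moreover have "real (l1 e) = \<bar>real_of_int (fst e)\<bar> + \<bar>real_of_int (snd e)\<bar>"
      by (simp add: l1_def)
    ultimately show ?thesis using n rvec_coords_le_norm[of e] by simp
  qed
  moreover have "diameter \<Omega> / h \<ge> 0"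
    using h compact_imp_bounded[OF \<Omega>] by (simp add: diameter_ge_0)
  ultimately have "real (stencil_size X V) \<le> 20 * (3 * (diameter \<Omega> / h)) * real (card X)"
    using total_card_le[of "3 * (diameter \<Omega> / h)"] by simp
  then show ?thesis by (simp add: mult_ac)
qed

theorem proposition1p10:
  "\<exists>C::real. C > 0 \<and>
     (\<forall>(\<Omega>::plane set) (h::real) (\<theta>::real) (\<xi>::plane) (X::plane set) (u::plane \<Rightarrow> real)
        (V::plane \<Rightarrow> zvec set).
        compact \<Omega> \<longrightarrow> convex \<Omega> \<longrightarrow> h > 0 \<longrightarrow> X = \<Omega> \<inter> grid h \<theta> \<xi> \<longrightarrow>
        u \<in> Conv_restr \<Omega> X \<longrightarrow> smallest_stencil_family h \<theta> X u V \<longrightarrow>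
        real (stencil_size X V) \<le> C * real (card X) * (diameter \<Omega> / h))"
proof (intro exI[of _ "60 :: real"] conjI allI impI)
  fix \<Omega> h \<theta> \<xi> X u V
  assume "compact \<Omega>" "h > 0" "X = \<Omega> \<inter> grid h \<theta> \<xi>" "u \<in> Conv_restr \<Omega> X"
    "smallest_stencil_family h \<theta> X u V"
  then show "real (stencil_size X V) \<le> 60 * real (card X) * (diameter \<Omega> / h)"
    by (rule stencil_size_le)
qed simp

end
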